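(* Let $\alpha>-1$ and let $n\in\mathbb N$ be fixed. As $t\to+\infty$, the Hankel determinant $D_n(t)$ has the asymptotic expansion $$\ln D_n(t)=-2n\sqrt t+\frac{n(2\alpha+n)}{4}\ln t+\widetilde C(n)+\frac{n\left[4(\alpha+n)^2-1\right]}{16\sqrt t}+O(t^{-1}),$$ where $\widetilde C(n)$ is the constant, independent of $t$, given by $$\widetilde C(n)=\frac{n\ln\pi}{2}-\frac{n(n-1)\ln2}{2}+\ln G(n+1),$$ and $G(\cdot)$ is the Barnes $G$-function.
   Context: For $\alpha>-1$, $t\ge0$, let $w(x;t,\alpha)=x^\alpha e^{-x-t/x}$ on $(0,\infty)$, with moments $\mu_j(t,\alpha)=\int_0^\infty x^jw(x;t,\alpha)\,dx$. The Hankel determinant is $D_n(t)=D_n(t,\alpha)=\det(\mu_{i+j}(t,\alpha))_{i,j=0}^{n-1}$. The Barnes $G$-function satisfies $G(z+1)=\Gamma(z)G(z)$, $G(1)=1$. $\mathbb N$ denotes the positive integers. *)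

theory Defs
  imports
    "HOL-Analysis.Analysis"
    "HOL-Library.Landau_Symbols"
    "HOL-Real_Asymp.Real_Asymp"
    "Jordan_Normal_Form.Determinant"
begin

definition weight :: "real \<Rightarrow> real \<Rightarrow> real \<Rightarrow> real" where
  "weight t \<alpha> x = x powr \<alpha> * exp (- x - t / x)"

definition moment :: "nat \<Rightarrow> real \<Rightarrow> real \<Rightarrow> real" where
  "moment j t \<alpha> = (LINT x:{0<..}|lborel. x ^ j * weight t \<alpha> x)"

definition hankel_D :: "nat \<Rightarrow> real \<Rightarrow> real \<Rightarrow> real" where
  "hankel_D n t \<alpha> = Determinant.det (mat n n (\<lambda>(i, j). moment (i + j) t \<alpha>))"

text \<open>
  The Barnes G-function, by its Weierstrass product
  \<open>G(1+w) = (2\<pi>)\<^bsup>w/2\<^esup> e\<^bsup>-(w + w\<^sup>2(1+\<gamma>))/2\<^esup> \<Prod>\<^sub>k\<^sub>\<ge>\<^sub>1 (1 + w/k)\<^bsup>k\<^esup> e\<^bsup>w\<^sup>2/(2k) - w\<^esup>\<close>.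
  The functional equation and \<open>G(1) = 1\<close> alone do not determine it away from the integers.
\<close>
definition barnes_G :: "'a :: {real_normed_field, banach} \<Rightarrow> 'a" where
  "barnes_G z = (let w = z - 1 in
     exp (w / 2 * of_real (ln (2 * pi)) - (w + w\<^sup>2 * (1 + euler_mascheroni)) / 2) *
     (\<Prod>k. (1 + w / of_nat (Suc k)) ^ Suc k * exp (w\<^sup>2 / (2 * of_nat (Suc k)) - w)))"

text \<open>
  The lemmas up to \<open>barnes_G_plus1\<close> check the product definition on the positive reals:
  \<open>G(1) = 1\<close> and \<open>G(x + 1) = \<Gamma>(x) G(x)\<close>. Both sides of the functional equation are compared
  through their partial products; the remaining constant is fixed by Stirling's formula.
\<close>

abbreviation barnes_factor :: "real \<Rightarrow> nat \<Rightarrow> real" where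
 "barnes_factor w k \<equiv> (1 + w / of_nat (Suc k)) ^ Suc k * exp (w\<^sup>2 / (2 * of_nat (Suc k)) - w)"

lemma barnes_factor_pos: "w > -1 \<Longrightarrow> barnes_factor w k > 0"
proof -
  assume "w > -1"
  then have "1 + w / real (Suc k) > 0" by (simp add: field_simps)
  then show ?thesis by simp
qed

lemma barnes_factor_bigo: assumes "w > -1" shows "(\<lambda>k. barnes_factor w k - 1) \<in> O(\<lambda>k. 1 / real k ^ 2)"
proof -
  have "(\<lambda>k. exp (real (Suc k) * ln (1 + w / real (Suc k)) + w\<^sup>2 / (2 * real (Suc k)) - w) - 1) \<in> O(\<lambda>k. 1 / real k ^ 2)"
  proof (cases w "0::real" rule: linorder_cases)
    case less
    then show ?thesis using assms unfolding power2_eq_square[of w] by real_asymp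
  next
    case greater
    then show ?thesis using assms unfolding power2_eq_square[of w] by real_asymp
  qed simp
  moreover have "barnes_factor w k = exp (real (Suc k) * ln (1 + w / real (Suc k)) + w\<^sup>2 / (2 * real (Suc k)) - w)" for k
  proof -
    have "1 + w / real (Suc k) > 0" using assms by (simp add: field_simps)
    then have "exp (real (Suc k) * ln (1 + w / real (Suc k))) = (1 + w / real (Suc k)) ^ Suc k"
      using exp_of_nat_mult[of "Suc k" "ln (1 + w / real (Suc k))"] by simp
    then show ?thesis by (simp only: exp_add exp_diff mult.assoc add_diff_eq[symmetric])
  qed
  ultimately show ?thesis by (simp only:)
qed

lemma barnes_prod_convergent: assumes "w > -1" shows "convergent_prod (barnes_factor w)"
proof -
  have sum: "summable (\<lambda>k. norm (1 / real k ^ 2))"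
    using inverse_power_summable[of 2, where 'a = real] by (simp add: inverse_eq_divide)
  have "(\<lambda>k. norm (barnes_factor w k - 1)) \<in> O(\<lambda>k. 1 / real k ^ 2)"
    unfolding real_norm_def using barnes_factor_bigo[OF assms] by (rule landau_o.big.abs_in_iff[THEN iffD2])
  from summable_comparison_test_bigo[OF sum this]
  have "summable (\<lambda>k. norm (barnes_factor w k - 1))" .
  then show ?thesis
    by (intro abs_convergent_prod_imp_convergent_prod summable_imp_abs_convergent_prod)
qed

lemma barnes_prod_LIMSEQ: assumes "w > -1" shows "(\<lambda>n. \<Prod>k<n. barnes_factor w k) \<longlonglongrightarrow> prodinf (barnes_factor w)"
proof -
  have "(\<lambda>n. \<Prod>k<Suc n. barnes_factor w k) \<longlonglongrightarrow> prodinf (barnes_factor w)"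
    using convergent_prod_LIMSEQ[OF barnes_prod_convergent[OF assms]] by (simp only: lessThan_Suc_atMost)
  then show ?thesis by (rule LIMSEQ_imp_Suc)
qed

lemma barnes_prod_pos: assumes "w > -1" shows "prodinf (barnes_factor w) > 0"
  by (rule less_0_prodinf[OF barnes_prod_convergent[OF assms] barnes_factor_pos[OF assms]])

lemma barnes_pochhammer_ratio:
  assumes "x > (0::real)"
  shows "(\<Prod>k<n. (1 + x / real (Suc k)) ^ Suc k) / (\<Prod>k<n. (1 + (x - 1) / real (Suc k)) ^ Suc k)
     = (x + real n) ^ n / pochhammer x n"
proof (induction n)
  case (Suc n)
  have p: "pochhammer x n > 0" using assms by (rule pochhammer_pos)
  have "1 + x / real (Suc n) = (x + real (Suc n)) / real (Suc n)"
       "1 + (x - 1) / real (Suc n) = (x + real n) / real (Suc n)"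
    by (simp_all add: field_simps)
  then have e: "(1 + x / real (Suc n)) ^ Suc n / (1 + (x - 1) / real (Suc n)) ^ Suc n
     = (x + real (Suc n)) ^ Suc n / (x + real n) ^ Suc n"
    by (simp only: power_divide) simp
  have nz: "x + real n > 0" using assms by simp
  have "(\<Prod>k<Suc n. (1 + x / real (Suc k)) ^ Suc k) / (\<Prod>k<Suc n. (1 + (x - 1) / real (Suc k)) ^ Suc k)
    = ((\<Prod>k<n. (1 + x / real (Suc k)) ^ Suc k) / (\<Prod>k<n. (1 + (x - 1) / real (Suc k)) ^ Suc k))
       * ((1 + x / real (Suc n)) ^ Suc n / (1 + (x - 1) / real (Suc n)) ^ Suc n)"
    by (simp only: prod.lessThan_Suc times_divide_times_eq)
  also have "\<dots> = (x + real n) ^ n / pochhammer x n * ((x + real (Suc n)) ^ Suc n / (x + real n) ^ Suc n)"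
    by (simp only: Suc.IH e)
  also have "\<dots> = (x + real (Suc n)) ^ Suc n / pochhammer x (Suc n)"
    using nz p by (simp add: pochhammer_Suc del: of_nat_Suc)
  finally show ?case .
qed simp

lemma harm_lessThan: "harm n = (\<Sum>k<n. 1 / real (Suc k))"
  unfolding harm_altdef by (simp add: inverse_eq_divide)

lemma barnes_prod_ratio:
  assumes "x > (0::real)"
  shows "(\<Prod>k<n. barnes_factor x k) / (\<Prod>k<n. barnes_factor (x - 1) k)
     = (x + real n) ^ n / pochhammer x n * exp ((x - 1/2) * harm n - real n)"
proof -
  have "(\<Prod>k<n. exp (x\<^sup>2 / (2 * real (Suc k)) - x)) / (\<Prod>k<n. exp ((x - 1)\<^sup>2 / (2 * real (Suc k)) - (x - 1)))
    = (\<Prod>k<n. exp ((x - 1/2) * (1 / real (Suc k)) - 1))"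
    unfolding prod_dividef[symmetric] exp_diff[symmetric]
  proof (intro prod.cong refl arg_cong[of _ _ exp])
    fix k
    have *: "x\<^sup>2 / (2 * m) - x - ((x - 1)\<^sup>2 / (2 * m) - (x - 1)) = (x - 1/2) * (1 / m) - 1" if "m > 0" for m :: real
      using that by (simp add: field_simps power2_eq_square)
    show "x\<^sup>2 / (2 * real (Suc k)) - x - ((x - 1)\<^sup>2 / (2 * real (Suc k)) - (x - 1)) = (x - 1/2) * (1 / real (Suc k)) - 1"
      by (rule *) simp
  qed
  also have "\<dots> = exp ((x - 1/2) * harm n - real n)"
    by (simp add: exp_sum[symmetric] sum_subtractf harm_lessThan sum_distrib_left)
  finally show ?thesis
    unfolding prod.distrib barnes_pochhammer_ratio[OF assms, symmetric] by (simp add: field_simps)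
qed

definition stirling_quot :: "nat \<Rightarrow> real" where
  "stirling_quot n = exp (real n * ln (real n) + ln (real n) / 2 - real n) / fact n"

lemma barnes_prod_ratio_LIMSEQ:
  assumes "x > (0::real)"
  shows "(\<lambda>n. stirling_quot n / ((\<Prod>k<n. barnes_factor x k) / (\<Prod>k<n. barnes_factor (x - 1) k)))
     \<longlonglongrightarrow> exp (- x - (x - 1/2) * euler_mascheroni) / Gamma x"
proof -
  define q where "q n = Gamma_series' x n" for n
  have q: "q \<longlonglongrightarrow> Gamma x" unfolding q_def by (rule Gamma_series'_LIMSEQ)
  have G: "Gamma x > 0" using assms by (rule Gamma_real_pos)
  have h: "(\<lambda>n. exp (- ((x - 1/2) * (harm n - ln (real n))))) \<longlonglongrightarrow> exp (- ((x - 1/2) * euler_mascheroni))"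
    by (intro tendsto_intros euler_mascheroni_LIMSEQ)
  have e: "(\<lambda>n. exp (real n * ln (real n) - real n * ln (x + real n))) \<longlonglongrightarrow> exp (- x)"
    using assms by real_asymp
  have "(\<lambda>n. exp (real n * ln (real n) - real n * ln (x + real n)) * exp (- ((x - 1/2) * (harm n - ln (real n)))) / q n)
     \<longlonglongrightarrow> exp (- x) * exp (- ((x - 1/2) * euler_mascheroni)) / Gamma x"
    using G by (intro tendsto_intros e h q) auto
  moreover have "\<forall>\<^sub>F n in sequentially. exp (real n * ln (real n) - real n * ln (x + real n)) * exp (- ((x - 1/2) * (harm n - ln (real n)))) / q n
     = stirling_quot n / ((\<Prod>k<n. barnes_factor x k) / (\<Prod>k<n. barnes_factor (x - 1) k))"
    using eventually_gt_at_top[of 0]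
  proof eventually_elim
    case (elim n)
    have p: "pochhammer x n > 0" using assms by (rule pochhammer_pos)
    have f: "fact n = real n * fact (n - 1)" using elim fact_reduce by blast
    have n: "exp (ln (real n)) = real n" using elim by simp
    have xn: "(x + real n) ^ n = exp (real n * ln (x + real n))"
      using assms exp_of_nat_mult[of n "ln (x + real n)"] by simp
    have ex: "exp (real n * ln (real n) - real n * ln (x + real n)) * exp (- ((x - 1/2) * (harm n - ln (real n))))
        * exp (real n * ln (x + real n)) * exp ((x - 1/2) * harm n - real n) * exp (ln (real n))
      = exp (real n * ln (real n) + ln (real n) / 2 - real n) * exp (x * ln (real n))"
      unfolding exp_add[symmetric] by (simp add: algebra_simps)
    have fp: "(fact (n - 1) :: real) > 0" by simp
    show ?case unfolding barnes_prod_ratio[OF assms] q_def Gamma_series'_def stirling_quot_def f xn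
      using p ex fp elim n by (simp add: field_simps)
  qed
  ultimately have "(\<lambda>n. stirling_quot n / ((\<Prod>k<n. barnes_factor x k) / (\<Prod>k<n. barnes_factor (x - 1) k)))
     \<longlonglongrightarrow> exp (- x) * exp (- ((x - 1/2) * euler_mascheroni)) / Gamma x"
    by (rule Lim_transform_eventually)
  then show ?thesis by (simp add: exp_add[symmetric])
qed

lemma stirling_quot_LIMSEQ: "stirling_quot \<longlonglongrightarrow> 1 / sqrt (2 * pi)"
proof -
  have "(\<lambda>n. stirling_quot n / ((\<Prod>k<n. barnes_factor 1 k) / (\<Prod>k<n. barnes_factor (1 - 1) k)) * ((\<Prod>k<n. barnes_factor 1 k) / (\<Prod>k<n. barnes_factor (1 - 1) k)))
    \<longlonglongrightarrow> exp (- 1 - (1 - 1/2) * euler_mascheroni) / Gamma 1 * (prodinf (barnes_factor 1) / prodinf (barnes_factor (1 - 1)))"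
    (is "_ \<longlonglongrightarrow> ?c")
    using barnes_prod_pos[of "1 - 1"]
    by (intro tendsto_mult tendsto_divide[OF barnes_prod_LIMSEQ barnes_prod_LIMSEQ] barnes_prod_ratio_LIMSEQ[of 1]) simp_all
  moreover have "stirling_quot n / ((\<Prod>k<n. barnes_factor 1 k) / (\<Prod>k<n. barnes_factor (1 - 1) k)) * ((\<Prod>k<n. barnes_factor 1 k) / (\<Prod>k<n. barnes_factor (1 - 1) k)) = stirling_quot n" for n
  proof -
    have pos: "((\<Prod>k<n. barnes_factor 1 k) / (\<Prod>k<n. barnes_factor (1 - 1) k)) > 0"
      by (intro divide_pos_pos prod_pos ballI barnes_factor_pos) simp_all
    have "a / b * b = a" if "b > 0" for a b :: real using that by simp
    from this[OF pos] show ?thesis .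
  qed
  ultimately have L: "stirling_quot \<longlonglongrightarrow> ?c" by simp
  have c: "?c > 0"
    using barnes_prod_pos[of 1] barnes_prod_pos[of "1 - 1"] by (intro mult_pos_pos divide_pos_pos) auto
  have "strict_mono (\<lambda>n::nat. 2 * n)" by (simp add: strict_mono_def)
  from LIMSEQ_subseq_LIMSEQ[OF L this] have "(\<lambda>n. stirling_quot (2 * n)) \<longlonglongrightarrow> ?c" by (simp add: o_def)
  then have A: "(\<lambda>n. stirling_quot n ^ 2 / stirling_quot (2 * n)) \<longlonglongrightarrow> ?c ^ 2 / ?c"
    using c L by (intro tendsto_divide tendsto_power) auto
  have "(\<lambda>n. 1 / Gamma_series' (1/2) n / sqrt 2) \<longlonglongrightarrow> 1 / Gamma (1/2) / sqrt (2::real)"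
    using Gamma_real_pos[of "1/2::real", THEN less_imp_neq] by (intro tendsto_intros Gamma_series'_LIMSEQ) auto
  moreover have "\<forall>\<^sub>F n in sequentially. 1 / Gamma_series' (1/2) n / sqrt 2 = stirling_quot n ^ 2 / stirling_quot (2 * n)"
    using eventually_gt_at_top[of 0]
  proof eventually_elim
    case (elim n)
    have f: "fact n = real n * fact (n - 1)" using elim fact_reduce by blast
    have n: "exp (ln (real n)) = real n" using elim by simp
    have s2: "sqrt 2 = exp (ln 2 / 2 :: real)" by (simp add: ln_sqrt[symmetric])
    have l2: "ln (real (2 * n)) = ln 2 + ln (real n)" using elim by (simp add: ln_mult)
    have p2: "2 ^ (2 * n) = exp (real (2 * n) * ln (2::real))"
      using exp_of_nat_mult[of "2 * n" "ln (2::real)"] by simp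
    have ex: "exp (real n * ln (real n) + ln (real n) / 2 - real n) ^ 2 * 2 ^ (2 * n) * sqrt 2 * exp (1 / 2 * ln (real n))
        = exp (real (2 * n) * ln (real (2 * n)) + ln (real (2 * n)) / 2 - real (2 * n)) * exp (ln (real n))"
      unfolding p2 s2 l2 power2_eq_square exp_add[symmetric] by (simp add: algebra_simps add_divide_distrib)
    have p: "pochhammer (1/2::real) n > 0" by (rule pochhammer_pos) simp
    have fp: "(fact (n - 1) :: real) > 0" by simp
    define a where "a = exp (real n * ln (real n) + ln (real n) / 2 - real n)"
    define b where "b = exp (real (2 * n) * ln (real (2 * n)) + ln (real (2 * n)) / 2 - real (2 * n))"
    define d where "d = exp (1 / 2 * ln (real n))"
    have pos: "a > 0" "b > 0" "d > 0" unfolding a_def b_def d_def by simp_all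
    have ex': "a ^ 2 * 2 ^ (2 * n) * sqrt 2 * d = b * real n" using ex unfolding a_def b_def d_def n .
    have "1 / Gamma_series' (1/2) n / sqrt 2 = pochhammer (1/2) n / (fact (n - 1) * d * sqrt 2)"
      unfolding Gamma_series'_def d_def by simp
    also have "\<dots> = (a / fact n) ^ 2 / (b / (2 ^ (2 * n) * pochhammer (1 / 2) n * fact n))"
    proof -
      have "(a / fact n) ^ 2 / (b / (2 ^ (2 * n) * pochhammer (1 / 2) n * fact n))
         = (a ^ 2 * 2 ^ (2 * n) * sqrt 2 * d) * pochhammer (1/2) n / (fact n * b * d * sqrt 2)"
        using pos by (simp add: field_simps power2_eq_square)
      also have "\<dots> = pochhammer (1/2) n / (fact (n - 1) * d * sqrt 2)"
        unfolding ex' f using pos fp elim by (simp add: field_simps)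
      finally show ?thesis ..
    qed
    also have "\<dots> = stirling_quot n ^ 2 / stirling_quot (2 * n)"
      unfolding stirling_quot_def a_def b_def fact_double by simp
    finally show ?case .
  qed
  ultimately have B: "(\<lambda>n. stirling_quot n ^ 2 / stirling_quot (2 * n)) \<longlonglongrightarrow> 1 / Gamma (1/2) / sqrt 2"
    by (rule Lim_transform_eventually)
  have "?c = ?c ^ 2 / ?c" using c by (simp only: power2_eq_square) auto
  also have "\<dots> = 1 / Gamma (1/2) / sqrt 2" by (rule LIMSEQ_unique[OF A B])
  also have "\<dots> = 1 / sqrt (2 * pi)" by (simp add: Gamma_one_half_real real_sqrt_mult)
  finally show ?thesis using L by simp
qed

lemma barnes_G_1 [simp]: "barnes_G 1 = 1"
  by (simp add: barnes_G_def)

lemma barnes_G_pos: "(x::real) > 0 \<Longrightarrow> barnes_G x > 0"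
  unfolding barnes_G_def Let_def using barnes_prod_pos[of "x - 1"] by (intro mult_pos_pos) auto

lemma barnes_G_plus1:
  assumes "(x::real) > 0"
  shows "barnes_G (x + 1) = Gamma x * barnes_G x"
proof -
  have w: "x > -1" "x - 1 > -1" using assms by simp_all
  have pos: "prodinf (barnes_factor x) > 0" "prodinf (barnes_factor (x - 1)) > 0"
    by (intro barnes_prod_pos w)+
  have G: "Gamma x > 0" using assms by (rule Gamma_real_pos)
  have "(\<lambda>n. stirling_quot n / ((\<Prod>k<n. barnes_factor x k) / (\<Prod>k<n. barnes_factor (x - 1) k)))
     \<longlonglongrightarrow> 1 / sqrt (2 * pi) / (prodinf (barnes_factor x) / prodinf (barnes_factor (x - 1)))"
    using pos by (intro tendsto_divide stirling_quot_LIMSEQ barnes_prod_LIMSEQ w) auto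
  from LIMSEQ_unique[OF this barnes_prod_ratio_LIMSEQ[OF assms]]
  have r: "1 / sqrt (2 * pi) / (prodinf (barnes_factor x) / prodinf (barnes_factor (x - 1)))
     = exp (- x - (x - 1/2) * euler_mascheroni) / Gamma x" .
  have s: "sqrt (2 * pi) = exp (ln (2 * pi) / 2)"
    by (simp add: ln_sqrt[symmetric])
  have e: "exp (x / 2 * ln (2 * pi) - (x + x\<^sup>2 * (1 + euler_mascheroni)) / 2)
     = exp ((x - 1) / 2 * ln (2 * pi) - ((x - 1) + (x - 1)\<^sup>2 * (1 + euler_mascheroni)) / 2)
        * (sqrt (2 * pi) * exp (- x - (x - 1/2) * euler_mascheroni))"
    unfolding s exp_add[symmetric] by (intro arg_cong[of _ _ exp]) (simp add: field_simps power2_eq_square)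
  have r': "sqrt (2 * pi) * exp (- x - (x - 1/2) * euler_mascheroni) * prodinf (barnes_factor x) = Gamma x * prodinf (barnes_factor (x - 1))"
  proof -
    define E where "E = exp (- x - (x - 1/2) * (euler_mascheroni::real))"
    define S where "S = sqrt (2 * pi)"
    have "S > 0" by (simp add: S_def)
    with r G pos show ?thesis unfolding E_def[symmetric] S_def[symmetric] by (simp add: field_simps)
  qed
  have "barnes_G (x + 1) = exp (x / 2 * ln (2 * pi) - (x + x\<^sup>2 * (1 + euler_mascheroni)) / 2) * prodinf (barnes_factor x)"
    unfolding barnes_G_def Let_def add_diff_cancel_right' of_real_eq_id id_apply ..
  also have "\<dots> = exp ((x - 1) / 2 * ln (2 * pi) - ((x - 1) + (x - 1)\<^sup>2 * (1 + euler_mascheroni)) / 2) 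
     * (sqrt (2 * pi) * exp (- x - (x - 1/2) * euler_mascheroni) * prodinf (barnes_factor x))"
    by (simp only: e mult.assoc)
  also have "\<dots> = Gamma x * barnes_G x"
    unfolding r' barnes_G_def Let_def of_real_eq_id id_apply by (simp only: mult.assoc mult.commute mult.left_commute)
  finally show ?thesis .
qed

definition C_tilde :: "nat \<Rightarrow> real" where
  "C_tilde n = real n * ln pi / 2 - real n * (real n - 1) * ln 2 / 2 + ln (barnes_G (real n + 1))"

end

theory Submission
  imports Defs "HOL-Probability.Distributions"
begin

text \<open>
  Write \<open>t = 1 / \<epsilon>\<^sup>4\<close> and substitute \<open>x = \<epsilon>\<^bsup>-2\<^esup> e\<^bsup>2a\<^esup>\<close> with \<open>sinh a = \<epsilon> z / 2\<close>. Then
  \<open>x + t / x = 2 / \<epsilon>\<^sup>2 + z\<^sup>2\<close>, so the weight becomes an exact Gaussian times a factor that is smooth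
  in \<open>\<epsilon> z\<close>, and \<open>\<epsilon> (x - 1 / \<epsilon>\<^sup>2) = z e\<^sup>a\<close> is a perturbation of \<open>z\<close>. The Hankel determinant does not
  change when the monomials are replaced by other monic polynomials; in the monic Hermite polynomials of the
  variable \<open>\<epsilon> (x - 1 / \<epsilon>\<^sup>2)\<close> the moment matrix is, up to explicit row and column factors,
  \<open>1 + \<epsilon> A + \<epsilon>\<^sup>2 B + O(\<epsilon>\<^sup>3)\<close>. The factors give the leading terms and the constant. By parity the
  determinant is \<open>1 + c \<epsilon>\<^sup>2 + O(\<epsilon>\<^sup>4)\<close> with \<open>c = \<Sum>\<^sub>i B\<^sub>i\<^sub>i - \<Sum>\<^sub>i\<^sub><\<^sub>j A\<^sub>i\<^sub>j A\<^sub>j\<^sub>i\<close>, and \<open>c\<close> is found by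
  induction on the size from the three-term recurrence.
\<close>

section \<open>The moments after the substitution\<close>

lemma power_le_exp: "x \<ge> 0 \<Longrightarrow> x ^ k / fact k \<le> exp (x :: real)"
proof -
  assume x: "x \<ge> 0"
  obtain t where "exp x = (\<Sum>m<Suc k. x ^ m / fact m) + exp t / fact (Suc k) * x ^ Suc k"
    using Maclaurin_exp_le[of x "Suc k"] by auto
  also have "\<dots> \<ge> (\<Sum>m<Suc k. x ^ m / fact m)" using x by simp
  also have "(\<Sum>m<Suc k. x ^ m / fact m) \<ge> x ^ k / fact k" using x by (simp add: sum_nonneg)
  finally show ?thesis by linarith
qed

lemma abs_arsinh_le: "\<bar>arsinh x\<bar> \<le> \<bar>x :: real\<bar>"
proof -
  have *: "arsinh x \<le> x" if "x \<ge> 0" for x :: real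
  proof -
    have "\<exists>y. ((\<lambda>x. x - arsinh x) has_real_derivative y) (at z) \<and> 0 \<le> y" for z :: real
    proof (rule exI[of _ "1 - 1 / sqrt (z\<^sup>2 + 1)"])
      have "((\<lambda>x. x - arsinh x) has_real_derivative 1 - 1 / sqrt (z\<^sup>2 + 1)) (at z)"
        by (auto intro!: derivative_eq_intros)
      moreover have "1 / sqrt (z\<^sup>2 + 1) \<le> 1 / 1"
        by (rule divide_left_mono) (auto intro: add_nonneg_pos)
      ultimately show "((\<lambda>x. x - arsinh x) has_real_derivative 1 - 1 / sqrt (z\<^sup>2 + 1)) (at z) \<and> 0 \<le> 1 - 1 / sqrt (z\<^sup>2 + 1)"
        by simp
    qed
    then have "0 - arsinh 0 \<le> x - arsinh x"
      using DERIV_nonneg_imp_nondecreasing[of 0 x "\<lambda>x. x - arsinh x"] that by simp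
    then show ?thesis by simp
  qed
  show ?thesis
    using *[of x] *[of "-x"] by (cases "x \<ge> 0") (auto simp: abs_if)
qed

text \<open>
  With \<open>a = arsinh (v / 2)\<close> and \<open>v = \<epsilon> z\<close> this is \<open>e\<^bsup>2\<kappa>a\<^esup> / cosh a\<close>: the powers of \<open>x\<close> in
  the integrand enter through \<open>\<kappa>\<close>, and \<open>1 / cosh a\<close> comes from \<open>dx / dz\<close>.
\<close>
definition gfac :: "real \<Rightarrow> real \<Rightarrow> real" where
  "gfac \<kappa> v = exp (2 * \<kappa> * arsinh (v / 2)) / sqrt (1 + (v / 2)\<^sup>2)"

text \<open>The Taylor polynomial of \<open>gfac \<kappa>\<close> at 0. It goes to third order
  because the final error O(1/t) is O(\<epsilon>^4).\<close>

definition gfac_cubic :: "real \<Rightarrow> real \<Rightarrow> real" where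
  "gfac_cubic \<kappa> v = 1 + \<kappa> * v + (4 * \<kappa>\<^sup>2 - 1) / 8 * v ^ 2 + (\<kappa> ^ 3 - \<kappa>) / 6 * v ^ 3"

lemma gfac_minus: "gfac \<kappa> (- v) = gfac (- \<kappa>) v"
  by (simp add: gfac_def)

lemma gfac_bound: "\<bar>gfac \<kappa> v\<bar> \<le> exp (\<bar>\<kappa>\<bar> * \<bar>v\<bar>)"
proof -
  have "2 * \<kappa> * arsinh (v / 2) \<le> \<bar>2 * \<kappa>\<bar> * \<bar>arsinh (v / 2)\<bar>"
    by (metis abs_ge_self abs_mult)
  also have "\<dots> \<le> \<bar>2 * \<kappa>\<bar> * \<bar>v / 2\<bar>"
    by (intro mult_left_mono abs_arsinh_le) auto
  finally have "exp (2 * \<kappa> * arsinh (v / 2)) \<le> exp (\<bar>\<kappa>\<bar> * \<bar>v\<bar>)" by (simp add: abs_mult)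
  moreover have "exp (2 * \<kappa> * arsinh (v / 2)) / sqrt (1 + (v / 2)\<^sup>2) \<le> exp (2 * \<kappa> * arsinh (v / 2)) / 1"
    by (intro divide_left_mono) (auto intro: add_pos_nonneg)
  ultimately show ?thesis
    unfolding gfac_def by (simp del: exp_le_cancel_iff)
qed

lemma bigo_cmult: "f \<in> O[F](g) \<Longrightarrow> (\<lambda>x. c * f x) \<in> O[F](g)" for c :: real
  by (cases "c = 0") simp_all

text \<open>Only the exponential depends on \<kappa>. Expanding it to third order in
  \<open>u\<close> leaves the \<kappa>-free functions \<open>u v ^ i / c v\<close>, whose expansions
  are explicit, and a remainder controlled by \<open>u v ^ 4\<close>.\<close>

lemma gfac_local:
  "(\<lambda>v. gfac \<kappa> v - gfac_cubic \<kappa> v) \<in> O[at_right 0](\<lambda>v. v ^ 4)"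
proof -
  define u c where "u v = 2 * arsinh (v / 2 :: real)" and "c v = sqrt (1 + (v / 2)\<^sup>2)" for v :: real
  define r where "r v = exp (\<kappa> * u v) - (\<Sum>i\<le>3. (\<kappa> * u v) ^ i / fact i)" for v
  have t: "(\<lambda>v. 1 / c v - (1 - v ^ 2 / 8)) \<in> O[at_right 0](\<lambda>v. v ^ 4)"
          "(\<lambda>v. u v / c v - (v - v ^ 3 / 6)) \<in> O[at_right 0](\<lambda>v. v ^ 4)"
          "(\<lambda>v. u v ^ 2 / c v - v ^ 2) \<in> O[at_right 0](\<lambda>v. v ^ 4)"
          "(\<lambda>v. u v ^ 3 / c v - v ^ 3) \<in> O[at_right 0](\<lambda>v. v ^ 4)"
          "(\<lambda>v. u v ^ 4 / c v) \<in> O[at_right 0](\<lambda>v. v ^ 4)"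
    unfolding u_def c_def arsinh_real_def power2_eq_square power3_eq_cube by real_asymp+
  have ul: "u \<midarrow>0\<rightarrow> 0"
    unfolding u_def by (rule tendsto_eq_intros refl | simp)+
  have "(\<lambda>v. exp (\<bar>\<kappa> * u v\<bar>)) \<in> O[at_right 0](\<lambda>_. 1)"
    by (rule bigoI_tendsto[where c = 1]) (auto intro!: tendsto_eq_intros tendsto_mono[OF _ ul] at_le)
  from landau_o.big.mult[OF this t(5)]
  have t5: "(\<lambda>v. exp (\<bar>\<kappa> * u v\<bar>) * (u v ^ 4 / c v)) \<in> O[at_right 0](\<lambda>v. v ^ 4)" by simp
  have "(\<lambda>v. r v / c v) \<in> O[at_right 0](\<lambda>v. \<bar>\<kappa>\<bar> ^ 4 * (exp (\<bar>\<kappa> * u v\<bar>) * (u v ^ 4 / c v)))"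
  proof (intro bigoI[of _ 1] always_eventually allI)
    fix v
    have c: "c v > 0" by (simp add: c_def add_pos_nonneg)
    have "\<bar>r v\<bar> \<le> exp \<bar>\<kappa> * u v\<bar> * \<bar>\<kappa> * u v\<bar> ^ 4 / 6"
      using Taylor_exp_field[of "\<kappa> * u v" 3] by (simp add: r_def fact_numeral)
    also have "\<dots> \<le> exp \<bar>\<kappa> * u v\<bar> * \<bar>\<kappa> * u v\<bar> ^ 4" by simp
    finally have "\<bar>r v\<bar> / c v \<le> exp \<bar>\<kappa> * u v\<bar> * \<bar>\<kappa> * u v\<bar> ^ 4 / c v"
      using c by (intro divide_right_mono) auto
    then show "norm (r v / c v) \<le> 1 * norm (\<bar>\<kappa>\<bar> ^ 4 * (exp (\<bar>\<kappa> * u v\<bar>) * (u v ^ 4 / c v)))"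
      using c by (simp add: abs_mult power_mult_distrib mult_ac)
  qed
  also have "(\<lambda>v. \<bar>\<kappa>\<bar> ^ 4 * (exp (\<bar>\<kappa> * u v\<bar>) * (u v ^ 4 / c v))) \<in> O[at_right 0](\<lambda>v. v ^ 4)"
    by (rule bigo_cmult[OF t5])
  finally have r: "(\<lambda>v. r v / c v) \<in> O[at_right 0](\<lambda>v. v ^ 4)" .
  have "gfac \<kappa> v - gfac_cubic \<kappa> v = r v / c v + (1 / c v - (1 - v ^ 2 / 8)) + \<kappa> * (u v / c v - (v - v ^ 3 / 6))
      + \<kappa> ^ 2 / 2 * (u v ^ 2 / c v - v ^ 2) + \<kappa> ^ 3 / 6 * (u v ^ 3 / c v - v ^ 3)" for v
  proof -
    have c: "c v > 0" by (simp add: c_def add_pos_nonneg)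
    have "gfac \<kappa> v = exp (\<kappa> * u v) / c v" by (simp add: gfac_def u_def c_def)
    also have "\<dots> = (r v + 1 + \<kappa> * u v + \<kappa>^2 * u v ^ 2 / 2 + \<kappa>^3 * u v ^ 3 / 6) / c v"
      by (simp add: r_def eval_nat_numeral field_simps)
    also have "\<dots> = r v / c v + 1 / c v + \<kappa> * (u v / c v) + \<kappa> ^ 2 / 2 * (u v ^ 2 / c v) + \<kappa> ^ 3 / 6 * (u v ^ 3 / c v)"
      by (simp add: add_divide_distrib)
    finally show ?thesis by (simp add: gfac_cubic_def field_simps)
  qed
  moreover have "(\<lambda>v. r v / c v + (1 / c v - (1 - v ^ 2 / 8)) + \<kappa> * (u v / c v - (v - v ^ 3 / 6))
      + \<kappa> ^ 2 / 2 * (u v ^ 2 / c v - v ^ 2) + \<kappa> ^ 3 / 6 * (u v ^ 3 / c v - v ^ 3)) \<in> O[at_right 0](\<lambda>v. v ^ 4)"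
    by (intro sum_in_bigo(1)[OF sum_in_bigo(1)[OF sum_in_bigo(1)[OF sum_in_bigo(1)[OF r t(1)]]]] bigo_cmult t)
  ultimately show ?thesis by simp
qed

text \<open>The estimate must hold for every real \<open>v\<close>, since it is integrated over the
  whole line with \<open>v = \<epsilon> * z\<close>. Near 0 it is the local expansion; away from 0
  both functions grow at most exponentially and \<open>v ^ 4\<close> is bounded below.\<close>

lemma gfac_expansion:
  obtains C where "C \<ge> 0" "\<And>v. \<bar>gfac \<kappa> v - gfac_cubic \<kappa> v\<bar> \<le> C * v ^ 4 * exp (C * \<bar>v\<bar>)"
proof -
  have right: "\<exists>C \<ge> 0. \<forall>v>0. \<bar>gfac \<kappa> v - gfac_cubic \<kappa> v\<bar> \<le> C * v ^ 4 * exp (C * v)" for \<kappa>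
  proof -
    obtain c where c: "c > 0" "eventually (\<lambda>v. \<bar>gfac \<kappa> v - gfac_cubic \<kappa> v\<bar> \<le> c * v ^ 4) (at_right 0)"
      using landau_o.bigE[OF gfac_local[of \<kappa>]] by auto
    then obtain d where d: "d > 0" "\<And>v. 0 < v \<Longrightarrow> v < d \<Longrightarrow> \<bar>gfac \<kappa> v - gfac_cubic \<kappa> v\<bar> \<le> c * v ^ 4"
      by (auto simp: eventually_at_right_field)
    \<comment> \<open>\<open>K * exp v\<close> bounds the cubic by
      \<open>v ^ k \<le> k! * exp v\<close>; the factors 2 and 6 are 2! and 3!.\<close>
    define K where "K = 1 + \<bar>\<kappa>\<bar> + \<bar>(4 * \<kappa>\<^sup>2 - 1) / 8\<bar> * 2 + \<bar>(\<kappa> ^ 3 - \<kappa>) / 6\<bar> * 6"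
    \<comment> \<open>One constant serves as prefactor and as rate: \<open>(1 + K) / d ^ 4\<close>
      covers \<open>v \<ge> d\<close>, while \<open>\<bar>\<kappa>\<bar>\<close> and 1 are the rates
      of \<open>gfac\<close> and of the cubic.\<close>
    define C where "C = c + (1 + K) / d ^ 4 + \<bar>\<kappa>\<bar> + 1"
    have K: "K \<ge> 1" by (simp add: K_def)
    have C: "C \<ge> 0" "C \<ge> c" "C \<ge> (1 + K) / d ^ 4" "C \<ge> \<bar>\<kappa>\<bar>" "C \<ge> 1" using c d K by (auto simp: C_def)
    have "\<bar>gfac \<kappa> v - gfac_cubic \<kappa> v\<bar> \<le> C * v ^ 4 * exp (C * v)" if v: "v > 0" for v
    proof (cases "v < d")
      case True
      have "\<bar>gfac \<kappa> v - gfac_cubic \<kappa> v\<bar> \<le> c * v ^ 4 * 1" using d v True by simp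
      also have "\<dots> \<le> C * v ^ 4 * exp (C * v)"
        using C c v by (intro mult_mono) auto
      finally show ?thesis .
    next
      case False
      have e: "v ^ k / fact k \<le> exp v" for k
        using power_le_exp[of v k] v by simp
      have "\<bar>gfac \<kappa> v\<bar> \<le> exp (\<bar>\<kappa>\<bar> * v)" using gfac_bound[of \<kappa> v] v by simp
      also have "\<dots> \<le> exp (C * v)" using C v by simp
      finally have 1: "\<bar>gfac \<kappa> v\<bar> \<le> exp (C * v)" .
      have "\<bar>gfac_cubic \<kappa> v\<bar> \<le> 1 + \<bar>\<kappa>\<bar> * v + \<bar>(4 * \<kappa>\<^sup>2 - 1) / 8\<bar> * v ^ 2 + \<bar>(\<kappa> ^ 3 - \<kappa>) / 6\<bar> * v ^ 3"
        unfolding gfac_cubic_def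
        by (intro order_trans[OF abs_triangle_ineq] add_mono) (use v in \<open>auto simp: abs_mult\<close>)
      also have "\<dots> \<le> exp v + \<bar>\<kappa>\<bar> * exp v + \<bar>(4 * \<kappa>\<^sup>2 - 1) / 8\<bar> * (2 * exp v) + \<bar>(\<kappa> ^ 3 - \<kappa>) / 6\<bar> * (6 * exp v)"
        using e[of 0] e[of 1] e[of 2] e[of 3]
        by (intro add_mono mult_left_mono) (auto simp: fact_numeral)
      also have "\<dots> = K * exp v" by (simp add: K_def algebra_simps)
      also have "\<dots> \<le> K * exp (C * v)" using K C v by simp
      finally have "\<bar>gfac \<kappa> v - gfac_cubic \<kappa> v\<bar> \<le> (1 + K) * exp (C * v)"
        using 1 by (simp add: algebra_simps)
      also have "(1 + K) \<le> C * d ^ 4" using C(3) d by (simp add: field_simps)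
      also have "C * d ^ 4 \<le> C * v ^ 4" using False C d by (intro mult_left_mono power_mono) auto
      finally show ?thesis by simp
    qed
    with C(1) show ?thesis by blast
  qed
  from right[of \<kappa>] right[of "- \<kappa>"]
  obtain C1 C2 where 1: "C1 \<ge> 0" "\<And>v. v > 0 \<Longrightarrow> \<bar>gfac \<kappa> v - gfac_cubic \<kappa> v\<bar> \<le> C1 * v ^ 4 * exp (C1 * v)"
    and 2: "C2 \<ge> 0" "\<And>v. v > 0 \<Longrightarrow> \<bar>gfac (-\<kappa>) v - gfac_cubic (-\<kappa>) v\<bar> \<le> C2 * v ^ 4 * exp (C2 * v)"
    by auto
  \<comment> \<open>Changing the sign of \<open>v\<close> amounts to changing that of \<kappa>, so
    negative \<open>v\<close> follow from the bound for \<open>-\<kappa>\<close>.\<close>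
  have sym: "gfac_cubic \<kappa> (-v) = gfac_cubic (-\<kappa>) v" for v
    by (simp add: gfac_cubic_def field_simps)
  have m: "C' * v ^ 4 * exp (C' * v) \<le> (C1 + C2) * v ^ 4 * exp ((C1 + C2) * v)"
    if "v > 0" "C' = C1 \<or> C' = C2" for v C'
    using that 1(1) 2(1) by (intro mult_mono) auto
  have "\<bar>gfac \<kappa> v - gfac_cubic \<kappa> v\<bar> \<le> (C1 + C2) * v ^ 4 * exp ((C1 + C2) * \<bar>v\<bar>)" for v
  proof (cases v "0 :: real" rule: linorder_cases)
    case less
    then show ?thesis using order_trans[OF 2(2)[of "-v"] m[of "-v" C2]] sym[of "-v"] gfac_minus[of \<kappa> "-v"] by simp
  next
    case greater
    then show ?thesis using order_trans[OF 1(2)[of v] m[of v C1]] by simp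
  qed (simp add: gfac_def gfac_cubic_def)
  with 1(1) 2(1) show ?thesis by (intro that[of "C1 + C2"]) auto
qed


section \<open>Moments of the Gaussian\<close>

definition gauss_moment :: "nat \<Rightarrow> real" where
  "gauss_moment k = (LINT z|lborel. z ^ k * exp (- z\<^sup>2))"

text \<open>The Gaussian is a multiple of the normal density of variance 1/2, which makes the known
  moments of normal densities available.\<close>

lemma gauss_normal_density: "exp (- z\<^sup>2) = sqrt pi * normal_density 0 (1 / sqrt 2) z"
  by (simp add: normal_density_def power_divide)

lemma gauss_moment_has_bochner_even:
  "has_bochner_integral lborel (\<lambda>z. z ^ (2 * k) * exp (- z\<^sup>2)) (sqrt pi * (fact (2 * k) / (4 ^ k * fact k)))"
  using has_bochner_integral_mult_right[OF normal_moment_even[of "1 / sqrt 2" 0 k], of "sqrt pi"]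
  unfolding gauss_normal_density by (simp add: power_divide mult_ac)

lemma gauss_moment_has_bochner_odd:
  "has_bochner_integral lborel (\<lambda>z::real. z ^ (2 * k + 1) * exp (- z\<^sup>2)) 0"
proof -
  have "(\<lambda>z. z ^ (2 * k + 1) * exp (- z\<^sup>2))
      = (\<lambda>z. sqrt pi * (normal_density 0 (1 / sqrt 2) z * (z - 0) ^ (2 * k + 1)))"
    by (simp add: fun_eq_iff gauss_normal_density)
  moreover have "has_bochner_integral lborel (\<lambda>z. sqrt pi * (normal_density 0 (1 / sqrt 2) z * (z - 0) ^ (2 * k + 1))) (sqrt pi * 0)"
    by (intro has_bochner_integral_mult_right normal_moment_odd) simp
  ultimately show ?thesis by (simp only: mult_zero_right)
qed

lemma gauss_moment_even: "gauss_moment (2 * k) = sqrt pi * (fact (2 * k) / (4 ^ k * fact k))"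
  unfolding gauss_moment_def using gauss_moment_has_bochner_even by (rule has_bochner_integral_integral_eq)

lemma gauss_moment_odd: "odd k \<Longrightarrow> gauss_moment k = 0"
  unfolding gauss_moment_def
  by (erule oddE) (simp only: has_bochner_integral_integral_eq[OF gauss_moment_has_bochner_odd])

lemma gauss_moment_0: "gauss_moment 0 = sqrt pi"
  using gauss_moment_even[of 0] by simp

text \<open>This is integration by parts for the Gaussian, read off from the closed formulas. All
  later algebra with Gaussian moments rests on it and on parity.\<close>

lemma gauss_moment_Suc_Suc: "gauss_moment (Suc (Suc k)) = (real k + 1) / 2 * gauss_moment k"
proof (cases "even k")
  case True
  then obtain l where k: "k = 2 * l" by (auto elim: evenE)
  have "gauss_moment (Suc (Suc k)) = gauss_moment (2 * Suc l)" by (simp add: k)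
  also have "\<dots> = (real k + 1) / 2 * gauss_moment k"
    unfolding k gauss_moment_even by (simp add: divide_simps) (simp add: algebra_simps)
  finally show ?thesis .
qed (simp add: gauss_moment_odd)

text \<open>The power is absorbed by \<open>\<bar>z\<bar> ^ k \<le> k! * exp \<bar>z\<bar>\<close>,
  which raises the rate to \<open>c + 1\<close>; completing the square then leaves a wider Gaussian.
  This is the dominating function for the integrals that follow.\<close>

lemma gauss_exp_integrable: "integrable lborel (\<lambda>z. \<bar>z\<bar> ^ k * exp (c * \<bar>z\<bar>) * exp (- z\<^sup>2 :: real))"
proof (rule Bochner_Integration.integrable_bound)
  show "integrable lborel (\<lambda>z. fact k * exp ((c + 1)\<^sup>2 / 2) * (sqrt (2 * pi) * normal_density 0 1 z))"
    by simp
  show "AE z in lborel. norm (\<bar>z\<bar> ^ k * exp (c * \<bar>z\<bar>) * exp (- z\<^sup>2))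
     \<le> norm (fact k * exp ((c + 1)\<^sup>2 / 2) * (sqrt (2 * pi) * normal_density 0 1 z))"
  proof (intro AE_I2)
    fix z :: real
    have "\<bar>z\<bar> ^ k * exp (c * \<bar>z\<bar>) * exp (- z\<^sup>2) \<le> (fact k * exp \<bar>z\<bar>) * exp (c * \<bar>z\<bar>) * exp (- z\<^sup>2)"
      using power_le_exp[of "\<bar>z\<bar>" k] by (intro mult_right_mono) (auto simp: field_simps)
    also have "\<dots> = fact k * exp ((c + 1) * \<bar>z\<bar> - z\<^sup>2)"
      by (simp add: exp_add[symmetric] exp_diff algebra_simps exp_minus field_simps)
    also have "(c + 1) * \<bar>z\<bar> - z\<^sup>2 \<le> (c + 1)\<^sup>2 / 2 - z\<^sup>2 / 2"
    proof -
      have "a * b - b\<^sup>2 \<le> a\<^sup>2 / 2 - b\<^sup>2 / 2" for a b :: real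
        using sum_squares_bound[of a b] by (simp add: field_simps)
      from this[of "c + 1" "\<bar>z\<bar>"] show ?thesis by (simp only: power2_abs)
    qed
    also have "fact k * exp ((c + 1)\<^sup>2 / 2 - z\<^sup>2 / 2) = fact k * exp ((c + 1)\<^sup>2 / 2) * (sqrt (2 * pi) * normal_density 0 1 z)"
    proof -
      have "sqrt (2 * pi) * normal_density 0 1 z = exp (- (z\<^sup>2 / 2))"
        by (simp add: normal_density_def)
      then show ?thesis by (simp only: mult.assoc exp_add[symmetric] diff_conv_add_uminus)
    qed
    finally show "norm (\<bar>z\<bar> ^ k * exp (c * \<bar>z\<bar>) * exp (- z\<^sup>2))
     \<le> norm (fact k * exp ((c + 1)\<^sup>2 / 2) * (sqrt (2 * pi) * normal_density 0 1 z))"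
      by (simp add: abs_mult)
  qed
qed simp

lemma gauss_moment_integrable: "integrable lborel (\<lambda>z. z ^ k * exp (- z\<^sup>2 :: real))"
  by (rule Bochner_Integration.integrable_bound[OF gauss_exp_integrable[of k 0]]) (auto simp: abs_mult power_abs)

section \<open>Perturbed Gaussian moments and the change of variables\<close>

lemma gfac_measurable [measurable]: "gfac \<kappa> \<in> borel_measurable borel"
  unfolding gfac_def
  by (intro borel_measurable_continuous_onI continuous_intros) (auto simp: add_nonneg_eq_0_iff)

definition gfac_moment :: "real \<Rightarrow> nat \<Rightarrow> real \<Rightarrow> real" where
  "gfac_moment \<kappa> m \<epsilon> = (LINT z|lborel. z ^ m * exp (- z\<^sup>2) * gfac \<kappa> (\<epsilon> * z))"

lemma gfac_moment_integrable: "integrable lborel (\<lambda>z. z ^ m * exp (- z\<^sup>2) * gfac \<kappa> (\<epsilon> * z))"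
proof (rule Bochner_Integration.integrable_bound[OF gauss_exp_integrable[of m "\<bar>\<kappa>\<bar> * \<bar>\<epsilon>\<bar>"]])
  show "AE z in lborel. norm (z ^ m * exp (- z\<^sup>2) * gfac \<kappa> (\<epsilon> * z))
      \<le> norm (\<bar>z\<bar> ^ m * exp (\<bar>\<kappa>\<bar> * \<bar>\<epsilon>\<bar> * \<bar>z\<bar>) * exp (- z\<^sup>2))"
  proof (intro AE_I2)
    fix z
    have "\<bar>z\<bar> ^ m * exp (- z\<^sup>2) * \<bar>gfac \<kappa> (\<epsilon> * z)\<bar> \<le> \<bar>z\<bar> ^ m * exp (- z\<^sup>2) * exp (\<bar>\<kappa>\<bar> * \<bar>\<epsilon> * z\<bar>)"
      by (intro mult_left_mono gfac_bound) auto
    then show "norm (z ^ m * exp (- z\<^sup>2) * gfac \<kappa> (\<epsilon> * z))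
      \<le> norm (\<bar>z\<bar> ^ m * exp (\<bar>\<kappa>\<bar> * \<bar>\<epsilon>\<bar> * \<bar>z\<bar>) * exp (- z\<^sup>2))"
      by (simp add: abs_mult power_abs mult_ac)
  qed
qed simp

text \<open>Integrating \<open>gfac_cubic\<close> term by term gives the main part; the pointwise
  remainder integrates to at most \<open>C * M * \<epsilon> ^ 4\<close>.\<close>

lemma gfac_moment_expansion:
  "(\<lambda>\<epsilon>. gfac_moment \<kappa> m \<epsilon> - (gauss_moment m + \<kappa> * gauss_moment (m + 1) * \<epsilon>
      + (4 * \<kappa>\<^sup>2 - 1) / 8 * gauss_moment (m + 2) * \<epsilon> ^ 2
      + (\<kappa> ^ 3 - \<kappa>) / 6 * gauss_moment (m + 3) * \<epsilon> ^ 3)) \<in> O[at_right 0](\<lambda>\<epsilon>. \<epsilon> ^ 4)"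
proof -
  obtain C where C: "C \<ge> 0" "\<And>v. \<bar>gfac \<kappa> v - gfac_cubic \<kappa> v\<bar> \<le> C * v ^ 4 * exp (C * \<bar>v\<bar>)"
    using gfac_expansion by blast
  define M where "M = (LINT z|lborel. \<bar>z\<bar> ^ (m + 4) * exp (C * \<bar>z\<bar>) * exp (- z\<^sup>2))"
  have "\<bar>gfac_moment \<kappa> m \<epsilon> - (gauss_moment m + \<kappa> * gauss_moment (m + 1) * \<epsilon>
      + (4 * \<kappa>\<^sup>2 - 1) / 8 * gauss_moment (m + 2) * \<epsilon> ^ 2
      + (\<kappa> ^ 3 - \<kappa>) / 6 * gauss_moment (m + 3) * \<epsilon> ^ 3)\<bar> \<le> (C * M) * \<epsilon> ^ 4"
    if \<epsilon>: "0 < \<epsilon>" "\<epsilon> < 1" for \<epsilon>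
  proof -
    let ?c = "\<lambda>z. (z ^ m * exp (- z\<^sup>2) + \<kappa> * \<epsilon> * (z ^ (m + 1) * exp (- z\<^sup>2))
        + (4 * \<kappa>\<^sup>2 - 1) / 8 * \<epsilon> ^ 2 * (z ^ (m + 2) * exp (- z\<^sup>2))
        + (\<kappa> ^ 3 - \<kappa>) / 6 * \<epsilon> ^ 3 * (z ^ (m + 3) * exp (- z\<^sup>2)))"
    note int = gauss_moment_integrable gfac_moment_integrable
    have c: "?c z = z ^ m * exp (- z\<^sup>2) * gfac_cubic \<kappa> (\<epsilon> * z)" for z
    proof -
      have "a * E + k * e * (a * y * E) + b * e ^ 2 * (a * y ^ 2 * E) + d * e ^ 3 * (a * y ^ 3 * E)
          = a * E * (1 + k * (e * y) + b * (e * y) ^ 2 + d * (e * y) ^ 3)" for a E k e y b d :: real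
        by (simp add: power_mult_distrib distrib_left mult_ac)
      then show ?thesis by (simp only: gfac_cubic_def power_add power_one_right)
    qed
    have ci: "integrable lborel ?c" by (intro Bochner_Integration.integrable_add integrable_mult_right int)
    have "gauss_moment m + \<kappa> * gauss_moment (m + 1) * \<epsilon>
      + (4 * \<kappa>\<^sup>2 - 1) / 8 * gauss_moment (m + 2) * \<epsilon> ^ 2
      + (\<kappa> ^ 3 - \<kappa>) / 6 * gauss_moment (m + 3) * \<epsilon> ^ 3 = integral\<^sup>L lborel ?c"
      unfolding gauss_moment_def
      by (subst Bochner_Integration.integral_add | intro Bochner_Integration.integrable_add integrable_mult_right int
           | subst integral_mult_right_zero)+ (simp add: mult_ac)
    then have "\<bar>gfac_moment \<kappa> m \<epsilon> - (gauss_moment m + \<kappa> * gauss_moment (m + 1) * \<epsilon>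
      + (4 * \<kappa>\<^sup>2 - 1) / 8 * gauss_moment (m + 2) * \<epsilon> ^ 2
      + (\<kappa> ^ 3 - \<kappa>) / 6 * gauss_moment (m + 3) * \<epsilon> ^ 3)\<bar>
      = \<bar>LINT z|lborel. z ^ m * exp (- z\<^sup>2) * gfac \<kappa> (\<epsilon> * z) - ?c z\<bar>"
      unfolding gfac_moment_def by (subst Bochner_Integration.integral_diff[OF int(2) ci]) simp
    also have "\<dots> \<le> (LINT z|lborel. \<bar>z ^ m * exp (- z\<^sup>2) * gfac \<kappa> (\<epsilon> * z) - ?c z\<bar>)"
      by (rule integral_abs_bound)
    also have "\<dots> \<le> (LINT z|lborel. (C * \<epsilon> ^ 4) * (\<bar>z\<bar> ^ (m + 4) * exp (C * \<bar>z\<bar>) * exp (- z\<^sup>2)))"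
    proof (rule integral_mono)
      fix z
      have "\<bar>z ^ m * exp (- z\<^sup>2) * gfac \<kappa> (\<epsilon> * z) - ?c z\<bar> = \<bar>z\<bar> ^ m * exp (- z\<^sup>2) * \<bar>gfac \<kappa> (\<epsilon> * z) - gfac_cubic \<kappa> (\<epsilon> * z)\<bar>"
        unfolding c right_diff_distrib[symmetric] by (simp add: abs_mult power_abs)
      also have "\<dots> \<le> \<bar>z\<bar> ^ m * exp (- z\<^sup>2) * (C * (\<epsilon> * z) ^ 4 * exp (C * \<bar>\<epsilon> * z\<bar>))"
        by (intro mult_left_mono C) auto
      \<comment> \<open>Here \<open>\<epsilon> < 1\<close> is used: it makes the integral
        \<open>M\<close> independent of \<epsilon>.\<close>
      also have "\<dots> \<le> \<bar>z\<bar> ^ m * exp (- z\<^sup>2) * (C * (\<epsilon> * z) ^ 4 * exp (C * \<bar>z\<bar>))"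
        using \<epsilon> C(1) by (intro mult_left_mono) (auto simp: abs_mult intro!: mult_left_mono mult_left_le_one_le)
      finally show "\<bar>z ^ m * exp (- z\<^sup>2) * gfac \<kappa> (\<epsilon> * z) - ?c z\<bar>
          \<le> (C * \<epsilon> ^ 4) * (\<bar>z\<bar> ^ (m + 4) * exp (C * \<bar>z\<bar>) * exp (- z\<^sup>2))"
        by (simp add: power_mult_distrib power_add mult_ac)
    qed (intro integrable_abs Bochner_Integration.integrable_diff ci int integrable_mult_right gauss_exp_integrable)+
    also have "\<dots> = (C * M) * \<epsilon> ^ 4" by (simp add: M_def)
    finally show ?thesis .
  qed
  then show ?thesis
    by (intro bigoI[of _ "C * M"] eventually_at_rightI[of 0 1]) auto
qed

text \<open>The map \<open>G\<close> below carries the line bijectively onto the half-line and turns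
  the weight into a Gaussian times \<open>gfac\<close>. All dependence on \<epsilon> beyond an
  explicit factor ends up in the argument of \<open>gfac\<close>.\<close>

lemma weight_substitution:
  assumes \<epsilon>: "\<epsilon> > 0"
  shows "set_integrable lborel {0<..} (\<lambda>x. (\<epsilon> * (x - 1 / \<epsilon>\<^sup>2)) ^ m * weight (1 / \<epsilon> ^ 4) \<alpha> x)" (is ?A)
    and "(LINT x:{0<..}|lborel. (\<epsilon> * (x - 1 / \<epsilon>\<^sup>2)) ^ m * weight (1 / \<epsilon> ^ 4) \<alpha> x)
      = \<epsilon> * (1 / \<epsilon>\<^sup>2) powr (\<alpha> + 1) * exp (- 2 / \<epsilon>\<^sup>2) * gfac_moment (m / 2 + (\<alpha> + 1)) m \<epsilon>" (is ?B)
proof -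
  define G where "G z = exp (2 * arsinh (\<epsilon> * z / 2)) / \<epsilon>\<^sup>2" for z
  define G' where "G' z = G z * (\<epsilon> / sqrt (1 + (\<epsilon> * z / 2)\<^sup>2))" for z
  define f where "f x = (\<epsilon> * (x - 1 / \<epsilon>\<^sup>2)) ^ m * weight (1 / \<epsilon> ^ 4) \<alpha> x" for x
  define K where "K = \<epsilon> * (1 / \<epsilon>\<^sup>2) powr (\<alpha> + 1) * exp (- 2 / \<epsilon>\<^sup>2)"
  have pos: "1 + (\<epsilon> * z / 2)\<^sup>2 > 0" for z by (simp add: add_pos_nonneg)
  have der: "(G has_field_derivative G' z) (at z within UNIV)" for z
    unfolding G_def G'_def using \<epsilon>
    by (auto intro!: derivative_eq_intros DERIV_chain2[OF arsinh_real_has_field_derivative] simp: add.commute field_simps eval_nat_numeral)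
  have inj: "inj_on G UNIV"
  proof (rule injI)
    fix x y assume "G x = G y"
    then have "arsinh (\<epsilon> * x / 2) = arsinh (\<epsilon> * y / 2)" using \<epsilon> by (simp add: G_def)
    then have "sinh (arsinh (\<epsilon> * x / 2)) = sinh (arsinh (\<epsilon> * y / 2))" by (rule arg_cong)
    then show "x = y" using \<epsilon> by simp
  qed
  have img: "G ` UNIV = {0<..}"
  proof (intro equalityI subsetI)
    fix x :: real assume x: "x \<in> {0<..}"
    \<comment> \<open>The preimage comes from solving \<open>exp (2 * a) / \<epsilon>^2 = x\<close>
      for \<open>a\<close> and then \<open>sinh a = \<epsilon> * z / 2\<close> for
      \<open>z\<close>.\<close>
    then have "G (2 / \<epsilon> * sinh (ln (\<epsilon>\<^sup>2 * x) / 2)) = x"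
      using \<epsilon> by (simp add: G_def arsinh_sinh_real)
    then show "x \<in> G ` UNIV" by (metis UNIV_I imageI)
  qed (use \<epsilon> in \<open>auto simp: G_def\<close>)
  have eq: "\<bar>G' z\<bar> * f (G z) = K * (z ^ m * exp (- z\<^sup>2) * gfac (m / 2 + (\<alpha> + 1)) (\<epsilon> * z))" for z
  proof -
    define a where "a = arsinh (\<epsilon> * z / 2)"
    have sa: "sinh a = \<epsilon> * z / 2" by (simp add: a_def)
    have Gz: "G z = exp (2 * a) / \<epsilon>\<^sup>2" by (simp add: G_def a_def)
    have ez: "exp a - exp (- a) = \<epsilon> * z" using sa by (simp add: sinh_def)
    have "exp (2 * a) - 1 = exp a * (exp a - exp (- a))"
      by (simp add: right_diff_distrib exp_add[symmetric] flip: exp_zero)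
    then have 1: "\<epsilon> * (G z - 1 / \<epsilon>\<^sup>2) = exp a * z"
      using \<epsilon> unfolding Gz ez by (simp add: field_simps power2_eq_square)
    have 2: "G z powr \<alpha> = (1 / \<epsilon>\<^sup>2) powr \<alpha> * exp (2 * a * \<alpha>)"
      using \<epsilon> by (simp add: Gz powr_divide exp_powr_real)
    have "G z + 1 / \<epsilon> ^ 4 / G z = (exp (2 * a) + exp (- (2 * a))) / \<epsilon>\<^sup>2"
      using \<epsilon> unfolding Gz by (simp add: exp_minus field_simps eval_nat_numeral)
    also have "exp (2 * a) + exp (- (2 * a)) = (exp a - exp (- a))\<^sup>2 + 2"
      by (simp add: power2_eq_square algebra_simps exp_add[symmetric] flip: exp_zero)
    also have "\<dots> / \<epsilon>\<^sup>2 = z\<^sup>2 + 2 / \<epsilon>\<^sup>2"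
      using \<epsilon> unfolding ez by (simp add: field_simps)
    finally have 3: "exp (- G z - 1 / \<epsilon> ^ 4 / G z) = exp (- 2 / \<epsilon>\<^sup>2) * exp (- z\<^sup>2)"
      by (simp add: exp_add[symmetric] minus_diff_eq[symmetric, of _ "- _"])
    define S where "S = sqrt (1 + (\<epsilon> * z / 2)\<^sup>2)"
    have S: "S > 0" using pos by (simp add: S_def)
    have 4: "\<bar>G' z\<bar> = exp (2 * a) / \<epsilon>\<^sup>2 * (\<epsilon> / S)"
      using \<epsilon> S by (simp add: G'_def Gz S_def[symmetric])
    \<comment> \<open>The parameter of \<open>gfac\<close> collects \<open>m / 2\<close> from
      \<open>(exp a * z) ^ m\<close>, \<alpha> from \<open>x powr \<alpha>\<close>, and 1 from
      \<open>exp (2 * a)\<close> in \<open>dx / dz\<close>.\<close>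
    have 5: "gfac (m / 2 + (\<alpha> + 1)) (\<epsilon> * z) = exp a ^ m * exp (2 * a * \<alpha>) * exp (2 * a) / S"
      by (simp add: gfac_def S_def a_def[symmetric] exp_add[symmetric] exp_of_nat_mult[symmetric] algebra_simps)
    show ?thesis
      unfolding f_def weight_def 1 2 3 4 5 K_def using \<epsilon> S
      by (simp add: powr_add power_mult_distrib)
  qed
  have int: "integrable lborel (\<lambda>z. \<bar>G' z\<bar> * f (G z))"
    unfolding eq by (intro integrable_mult_right gfac_moment_integrable)
  have val: "(LINT z|lborel. \<bar>G' z\<bar> * f (G z)) = K * gfac_moment (m / 2 + (\<alpha> + 1)) m \<epsilon>"
    unfolding eq gfac_moment_def by simp
  \<comment> \<open>The substitution theorem concerns absolute integrability and gauge integrals, so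
    the integral over \<open>lborel\<close> is first translated.\<close>
  have "(\<lambda>z. \<bar>G' z\<bar> * f (G z)) absolutely_integrable_on UNIV"
    using int by (simp add: set_integrable_def integrable_completion)
  moreover have "integral UNIV (\<lambda>z. \<bar>G' z\<bar> * f (G z)) = K * gfac_moment (m / 2 + (\<alpha> + 1)) m \<epsilon>"
    using integral_lborel[OF int] val by simp
  ultimately have f: "f absolutely_integrable_on {0<..}" "integral {0<..} f = K * gfac_moment (m / 2 + (\<alpha> + 1)) m \<epsilon>"
    using has_absolute_integral_change_of_variables_1'[OF _ der inj, of f "K * gfac_moment (m / 2 + (\<alpha> + 1)) m \<epsilon>"] img
    by auto
  \<comment> \<open>Borel measurability brings both results back from \<open>lebesgue\<close> to
    \<open>lborel\<close>.\<close>
  have meas: "f \<in> borel_measurable borel"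
    unfolding f_def weight_def by measurable
  have meas': "(\<lambda>x. indicator {0<..} x *\<^sub>R f x) \<in> borel_measurable lborel"
    using meas by measurable
  from f(1) show ?A
    unfolding f_def[symmetric] set_integrable_def by (simp only: integrable_completion[OF meas'])
  have "(LINT x:{0<..}|lborel. f x) = (LINT x:{0<..}|lebesgue. f x)"
    unfolding set_lebesgue_integral_def by (rule integral_completion[OF meas', symmetric])
  also have "\<dots> = integral {0<..} f"
    using f(1) by (rule set_lebesgue_integral_eq_integral)
  finally show ?B unfolding f(2) K_def f_def .
qed

section \<open>Hermite polynomials\<close>

definition lin_fun :: "(nat \<Rightarrow> real) \<Rightarrow> real poly \<Rightarrow> real" where
  "lin_fun h p = (\<Sum>i\<le>degree p. coeff p i * h i)"

lemma lin_fun_eq_sum: "degree p \<le> N \<Longrightarrow> lin_fun h p = (\<Sum>i\<le>N. coeff p i * h i)"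
  unfolding lin_fun_def by (rule sum.mono_neutral_left) (auto simp: coeff_eq_0)

lemma lin_fun_0 [simp]: "lin_fun h 0 = 0"
  by (simp add: lin_fun_def)

lemma lin_fun_add: "lin_fun h (p + q) = lin_fun h p + lin_fun h q"
proof -
  define N where "N = max (degree p) (degree q)"
  have "degree (p + q) \<le> N" "degree p \<le> N" "degree q \<le> N"
    by (auto simp: N_def degree_add_le)
  then show ?thesis by (simp add: lin_fun_eq_sum[of _ N] sum.distrib algebra_simps)
qed

lemma lin_fun_smult: "lin_fun h (Polynomial.smult c p) = c * lin_fun h p"
  using lin_fun_eq_sum[of "Polynomial.smult c p" "degree p" h]
  by (simp add: degree_smult_le lin_fun_def sum_distrib_left mult.assoc)

lemma lin_fun_uminus: "lin_fun h (- p) = - lin_fun h p"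
  using lin_fun_smult[of h "-1" p] by simp

lemma lin_fun_diff: "lin_fun h (p - q) = lin_fun h p - lin_fun h q"
  using lin_fun_add[of h p "- q"] by (simp add: lin_fun_uminus)

lemma lin_fun_sum: "lin_fun h (sum f A) = (\<Sum>x\<in>A. lin_fun h (f x))"
  by (induction A rule: infinite_finite_induct) (simp_all add: lin_fun_add)

lemma lin_fun_monom: "lin_fun h (monom c k) = c * h k"
proof -
  have "lin_fun h (monom c k) = (\<Sum>i\<le>k. coeff (monom c k) i * h i)"
    by (rule lin_fun_eq_sum[OF degree_monom_le])
  also have "\<dots> = (\<Sum>i\<le>k. if i = k then c * h k else 0)"
    by (intro sum.cong) auto
  finally show ?thesis by simp
qed

lemma lin_fun_pCons: "lin_fun h (pCons a p) = a * h 0 + lin_fun (\<lambda>i. h (Suc i)) p"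
  unfolding lin_fun_eq_sum[OF degree_pCons_le] sum.atMost_Suc_shift lin_fun_def[of _ p] by simp

lemmas lin_fun_linear = lin_fun_add lin_fun_diff lin_fun_smult lin_fun_uminus

lemma poly_eq_sum_monom: "degree p < n \<Longrightarrow> p = (\<Sum>k<n. monom (coeff p k) k)"
  using poly_as_sum_of_monoms'[of p "n - 1"] by (cases n) (simp_all add: lessThan_Suc_atMost)

lemma lin_fun_mult:
  assumes "degree p < n" "degree q < n"
  shows "lin_fun h (p * q) = (\<Sum>k<n. \<Sum>l<n. coeff p k * coeff q l * h (k + l))"
proof -
  have "p * q = (\<Sum>k<n. \<Sum>l<n. monom (coeff p k) k * monom (coeff q l) l)"
    using arg_cong2[OF poly_eq_sum_monom[OF assms(1)] poly_eq_sum_monom[OF assms(2)], of "(*)"]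
    by (simp only: sum_product)
  then show ?thesis by (simp add: lin_fun_sum mult_monom lin_fun_monom)
qed

text \<open>The change of basis is a congruence \<open>C * M * transpose_mat C\<close> whose
  \<open>C\<close>, the coefficient matrix, is lower triangular with unit diagonal.\<close>

lemma det_lin_fun_monic_basis:
  fixes q :: "nat \<Rightarrow> real poly"
  assumes deg: "\<And>i. degree (q i) = i" and monic: "\<And>i. coeff (q i) i = 1"
  shows "Determinant.det (mat n n (\<lambda>(i, j). lin_fun h (q i * q j))) = Determinant.det (mat n n (\<lambda>(i, j). h (i + j)))"
proof -
  define C where "C = mat n n (\<lambda>(i, k). coeff (q i) k)"
  define M where "M = mat n n (\<lambda>(i, j). h (i + j))"
  have [simp]: "C \<in> carrier_mat n n" "M \<in> carrier_mat n n" by (auto simp: C_def M_def)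
  have "Determinant.det C = prod_list (diag_mat C)"
    by (rule det_lower_triangular[of n]) (auto simp: C_def coeff_eq_0 deg)
  also have "\<dots> = 1"
  proof -
    have "diag_mat C = replicate n 1"
      by (rule nth_equalityI) (auto simp: diag_mat_def C_def monic)
    then show ?thesis by simp
  qed
  finally have C: "Determinant.det C = 1" .
  have "mat n n (\<lambda>(i, j). lin_fun h (q i * q j)) = C * M * transpose_mat C"
  proof (rule eq_matI)
    fix i j assume "i < dim_row (C * M * transpose_mat C)" "j < dim_col (C * M * transpose_mat C)"
    then have ij: "i < n" "j < n" by (auto simp: C_def)
    have "lin_fun h (q i * q j) = (\<Sum>k<n. \<Sum>l<n. coeff (q i) k * coeff (q j) l * h (k + l))"
      by (rule lin_fun_mult) (use ij in \<open>auto simp: deg\<close>)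
    also have "\<dots> = (\<Sum>l<n. (\<Sum>k<n. coeff (q i) k * h (k + l)) * coeff (q j) l)"
      by (subst sum.swap) (simp add: sum_distrib_left sum_distrib_right mult_ac)
    also have "\<dots> = (C * M * transpose_mat C) $$ (i, j)"
      using ij by (simp add: C_def M_def scalar_prod_def atLeast0LessThan)
    finally show "mat n n (\<lambda>(i, j). lin_fun h (q i * q j)) $$ (i, j) = (C * M * transpose_mat C) $$ (i, j)"
      using ij by simp
  qed (auto simp: C_def)
  then show ?thesis
    using det_mult[OF mult_carrier_mat[of C n n M n], of "transpose_mat C"] det_mult[of C n M] det_transpose[of C n] C
    by (simp add: M_def[symmetric])
qed

section \<open>Monic Hermite polynomials, \<open>2 ^ (-k) * H_k\<close> in physicists' notation, and
  their orthogonality\<close>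

primrec herm :: "nat \<Rightarrow> real poly" where
  "herm 0 = 1"
| "herm (Suc k) = [:0, 1:] * herm k - Polynomial.smult (1 / 2) (pderiv (herm k))"

lemma pderiv_herm: "pderiv (herm (Suc k)) = Polynomial.smult (real k + 1) (herm k)"
proof (induction k)
  case 0
  then show ?case by (simp add: pderiv_pCons)
next
  case (Suc k)
  have "pderiv (herm (Suc (Suc k))) = herm (Suc k) + [:0, 1:] * pderiv (herm (Suc k)) - Polynomial.smult (1 / 2) (pderiv (pderiv (herm (Suc k))))"
    by (subst herm.simps(2)) (simp add: pderiv_diff pderiv_smult pderiv_mult pderiv_pCons del: herm.simps)
  also have "\<dots> = herm (Suc k) + Polynomial.smult (real k + 1) ([:0, 1:] * herm k - Polynomial.smult (1 / 2) (pderiv (herm k)))"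
    unfolding Suc.IH by (simp add: pderiv_smult smult_diff_right mult.commute del: herm.simps)
  also have "\<dots> = Polynomial.smult (real (Suc k) + 1) (herm (Suc k))"
  proof -
    have "A + Polynomial.smult c A = Polynomial.smult (c + 1) A" for A :: "real poly" and c
      by (simp add: smult_add_left)
    from this[of "herm (Suc k)" "real k + 1"] show ?thesis by (simp add: add_ac)
  qed
  finally show ?case .
qed

lemma pderiv_herm': "pderiv (herm k) = Polynomial.smult (real k) (herm (k - 1))"
  by (cases k) (simp_all add: pderiv_herm add.commute del: herm.simps(2))

text \<open>The three-term recurrence. At \<open>k = 0\<close> the truncated index
  \<open>k - 1\<close> is harmless, its coefficient being 0.\<close>

lemma herm_shift: "[:0, 1:] * herm k = herm (Suc k) + Polynomial.smult (real k / 2) (herm (k - 1))"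
  by (simp add: pderiv_herm')

lemma degree_herm [simp]: "degree (herm k) = k" and coeff_herm_self [simp]: "coeff (herm k) k = 1"
proof -
  have "degree (herm k) = k \<and> coeff (herm k) k = 1"
  proof (induction k)
    case (Suc k)
    let ?a = "[:0, 1:] * herm k" and ?b = "Polynomial.smult (1 / 2) (pderiv (herm k))"
    have "degree ?b < Suc k"
      using Suc by (simp add: degree_pderiv)
    moreover have "herm k \<noteq> 0" using Suc by auto
    then have a: "degree ?a = Suc k" using Suc by simp
    ultimately have "degree (?a - ?b) = Suc k"
      using degree_add_eq_left[of "- ?b" ?a] by simp
    moreover have "coeff (?a - ?b) (Suc k) = 1"
      using Suc by (simp add: coeff_pderiv coeff_eq_0)
    ultimately show ?case by simp
  qed simp
  then show "degree (herm k) = k" "coeff (herm k) k = 1" by auto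
qed

lemma coeff_herm_parity: "odd (i + k) \<Longrightarrow> coeff (herm k) i = 0"
proof (induction k arbitrary: i)
  case 0
  then show ?case by (cases i) auto
next
  case (Suc k)
  then show ?case by (cases i) (auto simp: coeff_pderiv)
qed

lemma coeff_herm_mult_parity: "odd (m + i + j) \<Longrightarrow> coeff (herm i * herm j) m = 0"
  unfolding coeff_mult
proof (intro sum.neutral ballI)
  fix k assume *: "odd (m + i + j)" "k \<in> {..m}"
  then have "odd (k + i) \<or> odd (m - k + j)" by (auto simp: even_diff_nat)
  then show "coeff (herm i) k * coeff (herm j) (m - k) = 0"
    by (metis coeff_herm_parity mult_eq_0_iff)
qed

lemma pderiv_sum_poly: "pderiv (sum f A) = (\<Sum>x\<in>A. pderiv (f x :: real poly))"
  by (induction A rule: infinite_finite_induct) (simp_all add: pderiv_add)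

text \<open>Integration by parts in algebraic form: on monomials it is the recurrence of the
  moments, and linearity does the rest.\<close>

lemma gauss_functional_by_parts: "lin_fun gauss_moment (pderiv p) = 2 * lin_fun gauss_moment ([:0, 1:] * p)"
proof -
  have *: "lin_fun gauss_moment (pderiv (monom c k)) = 2 * lin_fun gauss_moment ([:0, 1:] * monom c k)" for c k
  proof (cases k)
    case (Suc l)
    then show ?thesis
      by (simp add: pderiv_monom lin_fun_monom lin_fun_pCons gauss_moment_Suc_Suc)
  qed (simp add: pderiv_monom lin_fun_monom lin_fun_pCons gauss_moment_odd)
  \<comment> \<open>The name \<open>s\<close> hides the occurrences of \<open>p\<close> in its own
    expansion, so that rewriting \<open>p\<close> to \<open>s\<close> terminates.\<close>
  define s where "s = (\<Sum>k<Suc (degree p). monom (coeff p k) k)"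
  have p: "p = s" unfolding s_def by (rule poly_eq_sum_monom) simp
  show ?thesis
    unfolding p unfolding s_def pderiv_sum_poly sum_distrib_left lin_fun_sum by (simp only: * )
qed

text \<open>The recursion of \<open>herm\<close> is the adjoint of half the derivative: up to the
  term kept on the right, \<open>herm (Suc k) * q\<close> has the form \<open>X * r - r' / 2\<close>
  with \<open>r = herm k * q\<close>, and the functional kills it.\<close>

lemma gauss_functional_herm_Suc:
  "lin_fun gauss_moment (herm (Suc k) * q) = lin_fun gauss_moment (herm k * pderiv q) / 2"
proof -
  have "herm (Suc k) * q = [:0, 1:] * (herm k * q) - Polynomial.smult (1 / 2) (pderiv (herm k * q)) + Polynomial.smult (1 / 2) (herm k * pderiv q)"
    by (simp add: pderiv_mult smult_add_right algebra_simps)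
  then show ?thesis
    by (simp only: lin_fun_linear gauss_functional_by_parts)
qed

definition herm_norm :: "nat \<Rightarrow> real" where
  "herm_norm k = sqrt pi * fact k / 2 ^ k"

lemma herm_norm_pos: "herm_norm k > 0"
  by (simp add: herm_norm_def)

lemma herm_norm_Suc: "herm_norm (Suc k) = (real k + 1) / 2 * herm_norm k"
  by (simp add: herm_norm_def field_simps)

text \<open>Moving a derivative from one factor to the other lowers both indices by one, down to a
  pairing with the constant polynomial.\<close>

lemma herm_orthogonal: "lin_fun gauss_moment (herm i * herm j) = (if i = j then herm_norm i else 0)"
proof (induction i arbitrary: j)
  case 0
  show ?case
  proof (cases j)
    case 0
    then show ?thesis by (simp add: herm_norm_def gauss_moment_0 lin_fun_def)
  next
    case (Suc l)
    then show ?thesis using gauss_functional_herm_Suc[of l 1] by (simp del: herm.simps(2))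
  qed
next
  case (Suc i)
  have "lin_fun gauss_moment (herm (Suc i) * herm j) = real j / 2 * lin_fun gauss_moment (herm i * herm (j - 1))"
    unfolding gauss_functional_herm_Suc pderiv_herm' by (simp add: lin_fun_smult)
  with Suc show ?case by (cases j) (auto simp: herm_norm_Suc)
qed

text \<open>
  The polynomials in the next two lemmas are the first two coefficients in \<open>\<epsilon>\<close> of
  \<open>(1 + \<epsilon>z)\<^bsup>\<nu>-1\<^esup> exp (z\<^sup>2 - z\<^sup>2 / (1 + \<epsilon>z))\<close>, the weight in the variable
  \<open>\<epsilon>\<^sup>2 x = 1 + \<epsilon>z\<close> relative to the Gaussian.
\<close>
lemma gfac_moment_coeff1:
  "lin_fun (\<lambda>m. (real m / 2 + \<nu>) * gauss_moment (m + 1)) p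
     = lin_fun gauss_moment ([:0, \<nu> - 1, 0, 1:] * p)"
proof -
  have "lin_fun gauss_moment ([:0, \<nu> - 1, 0, 1:] * p)
      = (\<nu> - 1) * lin_fun (\<lambda>i. gauss_moment (i + 1)) p + lin_fun (\<lambda>i. gauss_moment (i + 3)) p"
    by (simp add: lin_fun_pCons lin_fun_add lin_fun_smult eval_nat_numeral)
  also have "\<dots> = lin_fun (\<lambda>m. (real m / 2 + \<nu>) * gauss_moment (m + 1)) p"
    unfolding lin_fun_def sum_distrib_left sum.distrib[symmetric]
  proof (intro sum.cong refl)
    fix m
    \<comment> \<open>The dependence of the coefficient on \<open>m\<close> is traded for higher
      moments by the recurrence; this produces a polynomial factor that does not depend on
      \<open>m\<close>.\<close>
    have 3: "gauss_moment (m + 3) = (real m + 2) / 2 * gauss_moment (m + 1)"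
      using gauss_moment_Suc_Suc[of "m + 1"] by (simp add: eval_nat_numeral algebra_simps)
    show "(\<nu> - 1) * (coeff p m * gauss_moment (m + 1)) + coeff p m * gauss_moment (m + 3)
      = coeff p m * ((real m / 2 + \<nu>) * gauss_moment (m + 1))"
      unfolding 3 by (simp add: field_simps)
  qed
  finally show ?thesis ..
qed

lemma gfac_moment_coeff2:
  "lin_fun (\<lambda>m. (4 * (real m / 2 + \<nu>)\<^sup>2 - 1) / 8 * gauss_moment (m + 2)) p
     = lin_fun gauss_moment ([:0, 0, (\<nu> - 1) * (\<nu> - 2) / 2, 0, \<nu> - 2, 0, 1 / 2:] * p)"
proof -
  have "lin_fun gauss_moment ([:0, 0, (\<nu> - 1) * (\<nu> - 2) / 2, 0, \<nu> - 2, 0, 1 / 2:] * p)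
      = (\<nu> - 1) * (\<nu> - 2) / 2 * lin_fun (\<lambda>i. gauss_moment (i + 2)) p + (\<nu> - 2) * lin_fun (\<lambda>i. gauss_moment (i + 4)) p
        + 1 / 2 * lin_fun (\<lambda>i. gauss_moment (i + 6)) p"
    by (simp add: lin_fun_pCons lin_fun_add lin_fun_smult eval_nat_numeral)
  also have "\<dots> = lin_fun (\<lambda>m. (4 * (real m / 2 + \<nu>)\<^sup>2 - 1) / 8 * gauss_moment (m + 2)) p"
    unfolding lin_fun_def sum_distrib_left sum.distrib[symmetric]
  proof (intro sum.cong refl)
    fix m
    have 4: "gauss_moment (m + 4) = (real m + 3) / 2 * gauss_moment (m + 2)"
      using gauss_moment_Suc_Suc[of "m + 2"] by (simp add: eval_nat_numeral algebra_simps)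
    have 6: "gauss_moment (m + 6) = (real m + 5) / 2 * ((real m + 3) / 2 * gauss_moment (m + 2))"
      unfolding 4[symmetric] using gauss_moment_Suc_Suc[of "m + 4"] by (simp add: eval_nat_numeral algebra_simps)
    show "(\<nu> - 1) * (\<nu> - 2) / 2 * (coeff p m * gauss_moment (m + 2)) + (\<nu> - 2) * (coeff p m * gauss_moment (m + 4))
        + 1 / 2 * (coeff p m * gauss_moment (m + 6))
      = coeff p m * ((4 * (real m / 2 + \<nu>)\<^sup>2 - 1) / 8 * gauss_moment (m + 2))"
      unfolding 4 6 by (simp add: field_simps power2_eq_square)
  qed
  finally show ?thesis ..
qed

section \<open>Matrix elements of the first- and second-order terms in the Hermite basis\<close>

lemma herm_shift2:
  "[:0, 1:] * ([:0, 1:] * herm k) = herm (k + 2) + Polynomial.smult (real k + 1 / 2) (herm k)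
     + Polynomial.smult (real k * (real k - 1) / 4) (herm (k - 2))"
proof (cases "k = 0")
  case False
  then have *: "real (k - 1) = real k - 1" "Suc (k - 1) = k" "k - 1 - 1 = k - 2" by auto
  show ?thesis
    unfolding herm_shift distrib_left mult_smult_right *
    by (rule poly_eqI) (simp add: field_simps del: herm.simps)
qed (simp only: herm_shift distrib_left mult_smult_right, rule poly_eqI, simp del: herm.simps)

text \<open>The recurrence iterated three times. Wherever an index is truncated at 0, its
  coefficient vanishes.\<close>

lemma herm_shift3:
  "[:0, 1:] * ([:0, 1:] * ([:0, 1:] * herm k)) = herm (k + 3) + Polynomial.smult (3 * (real k + 1) / 2) (herm (k + 1))
     + Polynomial.smult (3 * (real k)\<^sup>2 / 4) (herm (k - 1)) + Polynomial.smult (real k * (real k - 1) * (real k - 2) / 8) (herm (k - 3))"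
\<comment> \<open>For \<open>k \<le> 1\<close> the index identity \<open>Suc (k - 2) = k - 1\<close>
  fails.\<close>
proof (cases "k \<le> 1")
  case True
  then have "k = 0 \<or> k = 1" by auto
  then show ?thesis
    unfolding herm_shift2
    by (elim disjE; simp only: herm_shift distrib_left mult_smult_right)
       (rule poly_eqI, simp add: eval_nat_numeral field_simps del: herm.simps)+
next
  case False
  then have *: "real (k - 2) = real k - 2" "Suc (k - 2) = k - 1" "k - 2 - 1 = k - 3" by auto
  show ?thesis
    unfolding herm_shift2 unfolding herm_shift distrib_left mult_smult_right *
    by (rule poly_eqI) (simp add: field_simps power2_eq_square eval_nat_numeral del: herm.simps)
qed

text \<open>Expand the polynomial times \<open>herm k\<close> by the recurrence. Above the diagonal
  only the components of degree \<open>k + 1\<close> and \<open>k + 3\<close> can meet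
  \<open>herm j\<close>.\<close>

lemma herm_matrix_upper:
  assumes "k < j"
  shows "lin_fun gauss_moment ([:0, a, 0, 1:] * (herm k * herm j))
     = (if j = k + 1 then (a + 3 * (real k + 1) / 2) * herm_norm j else 0) + (if j = k + 3 then herm_norm j else 0)"
proof -
  have "[:0, a, 0, 1:] * (herm k * herm j)
      = (Polynomial.smult a ([:0, 1:] * herm k) + [:0, 1:] * ([:0, 1:] * ([:0, 1:] * herm k))) * herm j"
    by (simp add: algebra_simps)
  also have "lin_fun gauss_moment \<dots> = (if j = k + 1 then (a + 3 * (real k + 1) / 2) * herm_norm j else 0) + (if j = k + 3 then herm_norm j else 0)"
    unfolding herm_shift3 unfolding herm_shift using assms
    by (simp only: distrib_right smult_add_right mult_smult_left smult_smult lin_fun_linear herm_orthogonal)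
       (auto simp: algebra_simps)
  finally show ?thesis .
qed

text \<open>The three brackets are the squared norms of \<open>X * herm n\<close>,
  \<open>X^2 * herm n\<close> and \<open>X^3 * herm n\<close> divided by \<open>herm_norm n\<close>,
  with the coefficients of the second-order polynomial.\<close>

definition herm_diag :: "real \<Rightarrow> real \<Rightarrow> real" where
  "herm_diag \<nu> n = (\<nu> - 1) * (\<nu> - 2) / 2 * (n + 1 / 2) + (\<nu> - 2) * (3 / 4 * (2 * n\<^sup>2 + 2 * n + 1))
     + 1 / 2 * ((n + 1) * (n + 2) * (n + 3) / 8 + 9 / 8 * (n + 1) ^ 3 + 9 / 8 * n ^ 3 + n * (n - 1) * (n - 2) / 8)"

text \<open>All powers in the polynomial are even, so each term is the square of a shifted
  \<open>herm n\<close>, and orthogonality reduces it to a sum of squared coefficients. The case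
  splits on \<open>n\<close> avoid colliding truncated indices.\<close>

lemma herm_matrix_diag:
  "lin_fun gauss_moment ([:0, 0, (\<nu> - 1) * (\<nu> - 2) / 2, 0, \<nu> - 2, 0, 1 / 2:] * (herm n * herm n))
     = herm_diag \<nu> n * herm_norm n"
proof -
  let ?X = "\<lambda>p. [:0, 1:] * p :: real poly" and ?L = "lin_fun gauss_moment"
  have "[:0, 0, (\<nu> - 1) * (\<nu> - 2) / 2, 0, \<nu> - 2, 0, 1 / 2:] * (herm n * herm n)
      = Polynomial.smult ((\<nu> - 1) * (\<nu> - 2) / 2) (?X (herm n) * ?X (herm n))
      + Polynomial.smult (\<nu> - 2) (?X (?X (herm n)) * ?X (?X (herm n)))
      + Polynomial.smult (1 / 2) (?X (?X (?X (herm n))) * ?X (?X (?X (herm n))))"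
    by (simp add: algebra_simps)
  then have "?L ([:0, 0, (\<nu> - 1) * (\<nu> - 2) / 2, 0, \<nu> - 2, 0, 1 / 2:] * (herm n * herm n))
      = (\<nu> - 1) * (\<nu> - 2) / 2 * ?L (?X (herm n) * ?X (herm n))
      + (\<nu> - 2) * ?L (?X (?X (herm n)) * ?X (?X (herm n)))
      + 1 / 2 * ?L (?X (?X (?X (herm n))) * ?X (?X (?X (herm n))))"
    by (simp only: lin_fun_linear)
  moreover have "?L (?X (herm n) * ?X (herm n)) = (n + 1 / 2) * herm_norm n"
  proof (cases n)
    case (Suc m)
    then show ?thesis unfolding herm_shift
      by (simp only: distrib_right distrib_left mult_smult_left mult_smult_right lin_fun_linear herm_orthogonal) (simp add: herm_norm_Suc field_simps)
  qed (simp only: herm_shift distrib_right distrib_left mult_smult_left mult_smult_right lin_fun_linear herm_orthogonal, simp add: herm_norm_Suc)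
  moreover have "?L (?X (?X (herm n)) * ?X (?X (herm n))) = 3 / 4 * (2 * (real n)\<^sup>2 + 2 * n + 1) * herm_norm n"
  proof -
    consider "n = 0" | "n = 1" | m where "n = Suc (Suc m)" by (metis One_nat_def not0_implies_Suc)
    then show ?thesis unfolding herm_shift2 distrib_right distrib_left mult_smult_left mult_smult_right lin_fun_linear herm_orthogonal
      by cases (simp_all add: herm_norm_Suc field_simps power2_eq_square eval_nat_numeral)
  qed
  moreover have "?L (?X (?X (?X (herm n))) * ?X (?X (?X (herm n))))
      = ((real n + 1) * (n + 2) * (n + 3) / 8 + 9 / 8 * (real n + 1) ^ 3 + 9 / 8 * real n ^ 3 + real n * (real n - 1) * (real n - 2) / 8) * herm_norm n"
  proof -
    consider "n = 0" | "n = 1" | "n = 2" | m where "n = Suc (Suc (Suc m))" by (metis One_nat_def not0_implies_Suc numeral_2_eq_2)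
    then show ?thesis unfolding herm_shift3 distrib_right distrib_left mult_smult_left mult_smult_right lin_fun_linear herm_orthogonal
      by cases (simp_all add: herm_norm_Suc field_simps eval_nat_numeral)
  qed
  ultimately show ?thesis
    by (simp only: herm_diag_def of_nat_add of_nat_mult of_nat_numeral distrib_right mult.assoc)
qed

text \<open>The product of the two mirror-image first-order entries: the numerator is symmetric in
  \<open>i\<close> and \<open>j\<close>, and each entry is normalised by the norm of its own
  row.\<close>

definition herm_off :: "real \<Rightarrow> nat \<Rightarrow> nat \<Rightarrow> real" where
  "herm_off \<nu> i j = lin_fun gauss_moment ([:0, \<nu> - 1, 0, 1:] * (herm i * herm j)) ^ 2 / (herm_norm i * herm_norm j)"

text \<open>By \<open>herm_matrix_upper\<close> only the rows \<open>n - 1\<close> and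
  \<open>n - 3\<close> contribute, each a squared coefficient times
  \<open>herm_norm n / herm_norm i\<close>.\<close>

lemma sum_herm_off:
  "(\<Sum>i<n. herm_off \<nu> i n) = real n / 2 * (\<nu> - 1 + 3 * real n / 2)\<^sup>2 + real n * (real n - 1) * (real n - 2) / 8"
proof -
  have off: "herm_off \<nu> i n = (if i = n - 1 then real n / 2 * (\<nu> - 1 + 3 * real n / 2)\<^sup>2 else 0)
      + (if i + 3 = n then real n * (real n - 1) * (real n - 2) / 8 else 0)" if i: "i < n" for i
  proof -
    note pos = herm_norm_pos
    have q: "(A * herm_norm n)\<^sup>2 / (herm_norm i * herm_norm n) = A\<^sup>2 * (herm_norm n / herm_norm i)" for A
      using pos[of i] pos[of n] by (simp add: power2_eq_square)
    consider "n = Suc i" | "n = Suc (Suc (Suc i))" | "n \<noteq> Suc i" "n \<noteq> i + 3" by fastforce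
    then show ?thesis
    proof cases
      case 1
      then have "lin_fun gauss_moment ([:0, \<nu> - 1, 0, 1:] * (herm i * herm n)) = (\<nu> - 1 + 3 * (real i + 1) / 2) * herm_norm n"
        unfolding herm_matrix_upper[OF i] by simp
      then have "herm_off \<nu> i n = (\<nu> - 1 + 3 * (real i + 1) / 2)\<^sup>2 * (herm_norm n / herm_norm i)"
        unfolding herm_off_def by (simp only: q)
      also have "herm_norm n / herm_norm i = (real i + 1) / 2"
        using 1 pos[of i] by (simp add: herm_norm_Suc)
      finally show ?thesis using 1 by (simp add: mult.commute add.commute)
    next
      case 2
      then have "lin_fun gauss_moment ([:0, \<nu> - 1, 0, 1:] * (herm i * herm n)) = 1 * herm_norm n"
        unfolding herm_matrix_upper[OF i] by simp
      then have "herm_off \<nu> i n = 1\<^sup>2 * (herm_norm n / herm_norm i)"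
        unfolding herm_off_def by (simp only: q)
      then have "herm_off \<nu> i n = herm_norm n / herm_norm i" by simp
      also have "\<dots> = (real i + 3) * (real i + 2) * (real i + 1) / 8"
        using 2 pos[of i] by (simp add: herm_norm_Suc add.commute)
      finally show ?thesis using 2 by (simp add: add.commute)
    next
      case 3
      then show ?thesis using i
        unfolding herm_off_def herm_matrix_upper[OF i] by auto
    qed
  qed
  have "(\<Sum>i<n. herm_off \<nu> i n) = (\<Sum>i<n. if i = n - 1 then real n / 2 * (\<nu> - 1 + 3 * real n / 2)\<^sup>2 else 0)
     + (\<Sum>i<n. if i + 3 = n then real n * (real n - 1) * (real n - 2) / 8 else 0)"
    by (simp add: off sum.distrib)
  also have "(\<Sum>i<n. if i = n - 1 then real n / 2 * (\<nu> - 1 + 3 * real n / 2)\<^sup>2 else 0) = real n / 2 * (\<nu> - 1 + 3 * real n / 2)\<^sup>2"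
    by (cases n) simp_all
  also have "(\<Sum>i<n. if i + 3 = n then real n * (real n - 1) * (real n - 2) / 8 else 0) = real n * (real n - 1) * (real n - 2) / 8"
  proof -
    have "n = 0 \<or> n = 1 \<or> n = 2 \<or> n = (n - 3) + 3" by auto
    then consider "n = 0" | "n = 1" | "n = 2" | m where "n = m + 3" by blast
    then show ?thesis
    proof cases
      case (4 m)
      then have "(\<Sum>i<n. if i + 3 = n then real n * (real n - 1) * (real n - 2) / 8 else 0)
        = (\<Sum>i<n. if i = m then real n * (real n - 1) * (real n - 2) / 8 else 0)" by (intro sum.cong) auto
      then show ?thesis using 4 by simp
    qed simp_all
  qed
  finally show ?thesis .
qed

text \<open>Passing from \<open>n\<close> to \<open>n + 1\<close> adds one diagonal term and one
  column sum, both known polynomials, so the induction step is a polynomial identity. With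
  \<open>\<nu> = \<alpha> + 1\<close> this is the coefficient in the theorem.\<close>

lemma second_order_coefficient:
  "(\<Sum>i<n. herm_diag \<nu> (real i)) - (\<Sum>j<n. \<Sum>i<j. herm_off \<nu> i j) = real n * (4 * (\<nu> - 1 + real n)\<^sup>2 - 1) / 16"
proof (induction n)
  case (Suc n)
  have "(\<Sum>i<Suc n. herm_diag \<nu> (real i)) - (\<Sum>j<Suc n. \<Sum>i<j. herm_off \<nu> i j)
      = real n * (4 * (\<nu> - 1 + real n)\<^sup>2 - 1) / 16 + herm_diag \<nu> n - (\<Sum>i<n. herm_off \<nu> i n)"
    using Suc.IH by simp
  also have "\<dots> = real (Suc n) * (4 * (\<nu> - 1 + real (Suc n))\<^sup>2 - 1) / 16"
    unfolding sum_herm_off herm_diag_def by (simp add: field_simps power2_eq_square power3_eq_cube)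
  finally show ?case .
qed simp

section \<open>Determinants close to the identity\<close>

lemma power_bigo_at_right_0: "m \<le> k \<Longrightarrow> (\<lambda>\<epsilon>::real. \<epsilon> ^ k) \<in> O[at_right 0](\<lambda>\<epsilon>. \<epsilon> ^ m)"
  by (rule bigoI[of _ 1], rule eventually_at_rightI[of 0 1]) (auto simp: power_decreasing)

lemma prod_bigo_power:
  assumes "finite A" "\<And>i. i \<in> A \<Longrightarrow> f i \<in> O[F](\<lambda>\<epsilon>::real. \<epsilon> ^ d i)"
  shows "(\<lambda>\<epsilon>. \<Prod>i\<in>A. f i \<epsilon> :: real) \<in> O[F](\<lambda>\<epsilon>. \<epsilon> ^ (\<Sum>i\<in>A. d i))"
  using assms
proof (induction A rule: finite_induct)
  case (insert x A)
  then have "(\<lambda>\<epsilon>. f x \<epsilon> * (\<Prod>i\<in>A. f i \<epsilon>)) \<in> O[F](\<lambda>\<epsilon>. \<epsilon> ^ d x * \<epsilon> ^ (\<Sum>i\<in>A. d i))"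
    by (intro landau_o.big.mult) auto
  with insert show ?case by (simp add: power_add)
qed simp

text \<open>If \<open>i\<close> is moved then so is \<open>p i\<close>, and these two exhaust the
  moved points. Since \<open>p (p i)\<close> is moved too and differs from \<open>p i\<close>, it
  equals \<open>i\<close>.\<close>

lemma permutes_few_moved_points:
  fixes p :: "nat \<Rightarrow> nat"
  assumes p: "p permutes {0..<n}" and "p \<noteq> id" and card: "card {i. i < n \<and> p i \<noteq> i} \<le> 2"
  obtains i j where "i < j" "j < n" "p = Transposition.transpose i j"
proof -
  let ?S = "{i. i < n \<and> p i \<noteq> i}"
  have inj: "inj p" using p by (rule permutes_inj)
  have out: "p k = k" if "k \<ge> n" for k using permutes_not_in[OF p, of k] that by auto
  obtain i where i: "p i \<noteq> i" using \<open>p \<noteq> id\<close> by (auto simp: fun_eq_iff)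
  have pi: "p (p i) \<noteq> p i" using i inj by (simp add: inj_eq)
  have ppi: "p (p (p i)) \<noteq> p (p i)" using pi inj by (simp add: inj_eq)
  have in_S: "k \<in> ?S" if "p k \<noteq> k" for k using that out[of k] by (cases "k < n") auto
  have "finite ?S" by simp
  moreover have "{i, p i} \<subseteq> ?S" using in_S[OF i] in_S[OF pi] by simp
  moreover have "card {i, p i} = 2" using i by simp
  ultimately have S: "?S = {i, p i}"
    using card by (metis card_seteq)
  have "p (p i) = i" using in_S[OF ppi] pi unfolding S by auto
  then have "p k = Transposition.transpose i (p i) k" for k
    using S in_S[of k] by (auto simp: Transposition.transpose_def)
  then have eq: "p = Transposition.transpose i (p i)" by blast
  have "i < n" "p i < n" using in_S[OF i] in_S[OF pi] by auto
  show ?thesis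
  proof (cases "i < p i")
    case True
    then show ?thesis using that eq \<open>p i < n\<close> by blast
  next
    case False
    then have "p i < i" using i by simp
    then show ?thesis using that[of "p i" i] eq \<open>i < n\<close> by (simp add: transpose_commute)
  qed
qed

text \<open>The power of \<epsilon> that an entry is guaranteed to carry: by parity, an entry off
  the diagonal with \<open>i + j\<close> even has no first-order term.\<close>

definition parity_order :: "nat \<Rightarrow> nat \<Rightarrow> nat" where
  "parity_order i j = (if i = j then 0 else if odd (i + j) then 1 else 2)"

text \<open>The sum has the parity of the sum of all \<open>i + p i\<close>, which is even. If below
  4 it is therefore at most 2, and it bounds the number of moved points.\<close>

lemma parity_order_sum_ge_4:
  assumes p: "p permutes {0..<n}" and "p \<noteq> id" and nt: "\<And>i j. i < j \<Longrightarrow> j < n \<Longrightarrow> p \<noteq> Transposition.transpose i j"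
  shows "(\<Sum>i = 0..<n. parity_order i (p i)) \<ge> 4"
proof (rule ccontr)
  let ?s = "\<Sum>i = 0..<n. parity_order i (p i)"
  assume "\<not> ?s \<ge> 4"
  moreover have "even ?s"
  proof -
    have "even ?s \<longleftrightarrow> even (\<Sum>i = 0..<n. i + p i)"
    proof (induction n)
      case (Suc n)
      have "even (parity_order n (p n)) \<longleftrightarrow> even (n + p n)" by (auto simp: parity_order_def)
      with Suc show ?case by simp
    qed simp
    also have "(\<Sum>i = 0..<n. i + p i) = 2 * (\<Sum>i = 0..<n. i)"
      using sum.permute[OF p, of "\<lambda>i. i"] by (simp add: sum.distrib)
    finally show ?thesis by simp
  qed
  ultimately have "?s \<le> 2" by presburger
  moreover have "card {i. i < n \<and> p i \<noteq> i} \<le> ?s"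
  proof -
    have "card {i. i < n \<and> p i \<noteq> i} = (\<Sum>i\<in>{i. i < n \<and> p i \<noteq> i}. 1)" by simp
    also have "\<dots> \<le> (\<Sum>i\<in>{i. i < n \<and> p i \<noteq> i}. parity_order i (p i))"
      by (intro sum_mono) (auto simp: parity_order_def)
    also have "\<dots> \<le> ?s" by (intro sum_mono2) auto
    finally show ?thesis .
  qed
  ultimately have "card {i. i < n \<and> p i \<noteq> i} \<le> 2" by simp
  from permutes_few_moved_points[OF p \<open>p \<noteq> id\<close> this] nt show False by metis
qed

text \<open>A permutation other than the identity and the transpositions contributes \<open>O(\<epsilon>\<^sup>4)\<close> to the
  Leibniz sum: it moves at least three points, and the number of factors of odd order is even.\<close>
lemma det_near_identity:
  fixes N :: "nat \<Rightarrow> nat \<Rightarrow> real \<Rightarrow> real"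
  assumes diag: "\<And>i. i < n \<Longrightarrow> (\<lambda>\<epsilon>. N i i \<epsilon> - (1 + b i * \<epsilon> ^ 2)) \<in> O[at_right 0](\<lambda>\<epsilon>. \<epsilon> ^ 4)"
    and off_odd: "\<And>i j. i < n \<Longrightarrow> j < n \<Longrightarrow> odd (i + j) \<Longrightarrow> (\<lambda>\<epsilon>. N i j \<epsilon> - a i j * \<epsilon>) \<in> O[at_right 0](\<lambda>\<epsilon>. \<epsilon> ^ 3)"
    and off_even: "\<And>i j. i < n \<Longrightarrow> j < n \<Longrightarrow> i \<noteq> j \<Longrightarrow> even (i + j) \<Longrightarrow> N i j \<in> O[at_right 0](\<lambda>\<epsilon>. \<epsilon> ^ 2)"
    and a_even: "\<And>i j. even (i + j) \<Longrightarrow> a i j = 0"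
  shows "(\<lambda>\<epsilon>. Determinant.det (mat n n (\<lambda>(i, j). N i j \<epsilon>))
           - (1 + ((\<Sum>i<n. b i) - (\<Sum>j<n. \<Sum>i<j. a i j * a j i)) * \<epsilon> ^ 2)) \<in> O[at_right 0](\<lambda>\<epsilon>. \<epsilon> ^ 4)"
proof -
  let ?O = "\<lambda>k. O[at_right 0](\<lambda>\<epsilon>::real. \<epsilon> ^ k)"
  have mono: "f \<in> ?O k \<Longrightarrow> m \<le> k \<Longrightarrow> f \<in> ?O m" for f k m
    by (rule landau_o.big.trans[OF _ power_bigo_at_right_0])
  have mult: "f \<in> ?O k \<Longrightarrow> g \<in> ?O l \<Longrightarrow> (\<lambda>\<epsilon>. f \<epsilon> * g \<epsilon>) \<in> ?O (k + l)" for f g k l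
    unfolding power_add by (rule landau_o.big.mult)
  have pw: "(\<lambda>\<epsilon>. \<epsilon> ^ k) \<in> ?O k" for k by simp
  have c1: "(\<lambda>_. c) \<in> ?O 0" for c by simp
  have d1: "(\<lambda>\<epsilon>. N i i \<epsilon> - 1) \<in> ?O 2" if "i < n" for i
  proof -
    have "(\<lambda>\<epsilon>. (N i i \<epsilon> - (1 + b i * \<epsilon> ^ 2)) + b i * \<epsilon> ^ 2) \<in> ?O 2"
      by (intro sum_in_bigo(1) bigo_cmult pw mono[OF diag[OF that]]) simp
    then show ?thesis by simp
  qed
  have d0: "N i i \<in> ?O 0" if "i < n" for i
  proof -
    have "(\<lambda>\<epsilon>. (N i i \<epsilon> - 1) + 1) \<in> ?O 0"
      by (intro sum_in_bigo(1) c1 mono[OF d1[OF that]]) simp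
    then show ?thesis by simp
  qed
  have o1: "N i j \<in> ?O 1" if "i < n" "j < n" "odd (i + j)" for i j
  proof -
    have "(\<lambda>\<epsilon>. (N i j \<epsilon> - a i j * \<epsilon>) + a i j * \<epsilon> ^ 1) \<in> ?O 1"
      by (intro sum_in_bigo(1) bigo_cmult pw) (use mono[OF off_odd[OF that], of 1] in simp)
    then show ?thesis by simp
  qed
  have ord: "N i j \<in> ?O (parity_order i j)" if "i < n" "j < n" for i j
    using d0[OF that(1)] o1[OF that] off_even[OF that] by (auto simp: parity_order_def)

  have diag_prod: "(\<lambda>\<epsilon>. (\<Prod>i\<in>K. N i i \<epsilon>) - (1 + (\<Sum>i\<in>K. b i) * \<epsilon> ^ 2)) \<in> ?O 4"
    if "finite K" "K \<subseteq> {..<n}" for K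
    using that
  proof (induction K rule: finite_induct)
    case (insert x K)
    then have x: "x < n" and IH: "(\<lambda>\<epsilon>. (\<Prod>i\<in>K. N i i \<epsilon>) - (1 + (\<Sum>i\<in>K. b i) * \<epsilon> ^ 2)) \<in> ?O 4" by auto
    let ?B = "\<Sum>i\<in>K. b i"
    \<comment> \<open>The difference for \<open>insert x K\<close>, regrouped into terms that are
      each O(\<epsilon>^4).\<close>
    have "(\<lambda>\<epsilon>. N x x \<epsilon> * ((\<Prod>i\<in>K. N i i \<epsilon>) - (1 + ?B * \<epsilon> ^ 2))
        + ((N x x \<epsilon> - (1 + b x * \<epsilon> ^ 2)) + ?B * ((N x x \<epsilon> - 1) * \<epsilon> ^ 2))) \<in> ?O 4"
      using mult[OF d0[OF x] IH] diag[OF x] mult[OF d1[OF x] pw[of 2]]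
      by (intro sum_in_bigo(1) bigo_cmult) simp_all
    then show ?case using insert.hyps by (simp add: algebra_simps)
  qed simp

  have rest: "(\<lambda>\<epsilon>. (\<Prod>i\<in>K. N i i \<epsilon>) - 1) \<in> ?O 2" if "finite K" "K \<subseteq> {..<n}" for K
  proof -
    have "(\<lambda>\<epsilon>. ((\<Prod>i\<in>K. N i i \<epsilon>) - (1 + (\<Sum>i\<in>K. b i) * \<epsilon> ^ 2)) + (\<Sum>i\<in>K. b i) * \<epsilon> ^ 2) \<in> ?O 2"
      by (intro sum_in_bigo(1) bigo_cmult pw mono[OF diag_prod[OF that]]) simp
    then show ?thesis by simp
  qed

  have two: "(\<lambda>\<epsilon>. N i j \<epsilon> * N j i \<epsilon> - a i j * a j i * \<epsilon> ^ 2) \<in> ?O 4"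
    and two': "(\<lambda>\<epsilon>. N i j \<epsilon> * N j i \<epsilon>) \<in> ?O 2" if ij: "i < n" "j < n" "i \<noteq> j" for i j
  proof -
    show "(\<lambda>\<epsilon>. N i j \<epsilon> * N j i \<epsilon> - a i j * a j i * \<epsilon> ^ 2) \<in> ?O 4"
    proof (cases "even (i + j)")
      case True
      \<comment> \<open>Both factors are O(\<epsilon>^2), and the coefficient \<open>a i j\<close>
        vanishes.\<close>
      then show ?thesis using mult[OF off_even[of i j] off_even[of j i]] ij a_even[of i j]
        by (simp add: add.commute)
    next
      case False
      have "(\<lambda>\<epsilon>. (N i j \<epsilon> - a i j * \<epsilon>) * N j i \<epsilon> + a i j * (\<epsilon> ^ 1 * (N j i \<epsilon> - a j i * \<epsilon>))) \<in> ?O 4"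
        using mult[OF off_odd[of i j] o1[of j i]] mult[OF pw[of 1] off_odd[of j i]] ij False
        by (intro sum_in_bigo(1) bigo_cmult) (simp_all add: add.commute)
      then show ?thesis by (simp add: algebra_simps power2_eq_square)
    qed
    show "(\<lambda>\<epsilon>. N i j \<epsilon> * N j i \<epsilon>) \<in> ?O 2"
      using mono[OF mult[OF ord[of i j] ord[of j i]], of 2] ij by (simp add: parity_order_def)
  qed

  define t where "t p \<epsilon> = signof p * (\<Prod>i = 0..<n. N i (p i) \<epsilon>)" for p \<epsilon>
  define P where "P = {p. p permutes {0..<n}}"
  \<comment> \<open>Indexing by \<open>(j, i)\<close> with \<open>i < j\<close> counts each
    transposition once and gives the double sum of the statement.\<close>
  define T where "T = (\<lambda>(j, i). Transposition.transpose i j) ` Sigma {..<n} (\<lambda>j. {..<j})"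
  define R where "R = P - {id} - T"
  have finP: "finite P" unfolding P_def by (rule finite_permutations) simp
  have TP: "T \<subseteq> P - {id}"
  proof
    fix p assume "p \<in> T"
    then obtain i j where ij: "i < j" "j < n" "p = Transposition.transpose i j" by (auto simp: T_def)
    then have "p permutes {0..<n}" by (auto intro: permutes_swap_id)
    moreover have "p i \<noteq> id i" using ij by simp
    ultimately show "p \<in> P - {id}" by (auto simp: P_def)
  qed
  have inj: "inj_on (\<lambda>(j, i). Transposition.transpose i j) (Sigma {..<n} (\<lambda>j. {..<j}))"
  proof (rule inj_onI, clarsimp)
    fix i j i' j' :: nat
    assume *: "i < j" "i' < j'" "Transposition.transpose i j = Transposition.transpose i' j'"
    have "{k. Transposition.transpose i j k \<noteq> k} = {i, j}" if "i < j" for i j :: nat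
      using that by (auto simp: Transposition.transpose_def)
    then have "{i, j} = {i', j'}" using * by metis
    then show "j = j' \<and> i = i'" using *(1,2) by (auto simp: doubleton_eq_iff)
  qed
  have det: "Determinant.det (mat n n (\<lambda>(i, j). N i j \<epsilon>)) = t id \<epsilon> + ((\<Sum>j<n. \<Sum>i<j. t (Transposition.transpose i j) \<epsilon>) + (\<Sum>p\<in>R. t p \<epsilon>))" for \<epsilon>
  proof -
    have "Determinant.det (mat n n (\<lambda>(i, j). N i j \<epsilon>)) = (\<Sum>p\<in>P. t p \<epsilon>)"
      unfolding P_def t_def
      by (subst det_def'[of _ n]) (auto intro!: sum.cong prod.cong dest: permutes_in_image)
    also have "\<dots> = t id \<epsilon> + (\<Sum>p\<in>P - {id}. t p \<epsilon>)"
      by (rule sum.remove[OF finP]) (simp add: P_def permutes_id)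
    also have "(\<Sum>p\<in>P - {id}. t p \<epsilon>) = (\<Sum>p\<in>T. t p \<epsilon>) + (\<Sum>p\<in>R. t p \<epsilon>)"
      unfolding R_def using finP by (subst sum.subset_diff[OF TP]) (simp_all add: add.commute)
    also have "(\<Sum>p\<in>T. t p \<epsilon>) = (\<Sum>j<n. \<Sum>i<j. t (Transposition.transpose i j) \<epsilon>)"
      unfolding T_def sum.reindex[OF inj] by (subst sum.Sigma) (auto intro!: sum.cong)
    finally show ?thesis .
  qed
  have R: "(\<lambda>\<epsilon>. \<Sum>p\<in>R. t p \<epsilon>) \<in> ?O 4"
  proof (rule big_sum_in_bigo)
    fix p assume "p \<in> R"
    then have p: "p permutes {0..<n}" "p \<noteq> id" "\<And>i j. i < j \<Longrightarrow> j < n \<Longrightarrow> p \<noteq> Transposition.transpose i j"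
      by (auto simp: R_def P_def T_def image_iff)
    have "(\<lambda>\<epsilon>. \<Prod>i = 0..<n. N i (p i) \<epsilon>) \<in> ?O (\<Sum>i = 0..<n. parity_order i (p i))"
      by (intro prod_bigo_power ord) (use permutes_in_image[OF p(1)] in auto)
    from mono[OF this parity_order_sum_ge_4[OF p]]
    show "t p \<in> ?O 4" unfolding t_def by (rule bigo_cmult)
  qed
  have t_id: "(\<lambda>\<epsilon>. t id \<epsilon> - (1 + (\<Sum>i<n. b i) * \<epsilon> ^ 2)) \<in> ?O 4"
    using diag_prod[of "{..<n}"] by (simp add: t_def sign_id atLeast0LessThan)
  have t_transpose: "(\<lambda>\<epsilon>. t (Transposition.transpose i j) \<epsilon> + a i j * a j i * \<epsilon> ^ 2) \<in> ?O 4" if ij: "i < j" "j < n" for i j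
  proof -
    let ?K = "{0..<n} - {i} - {j}"
    have K: "finite ?K" "?K \<subseteq> {..<n}" by auto
    have "t (Transposition.transpose i j) \<epsilon> = - (N i j \<epsilon> * N j i \<epsilon> * (\<Prod>k\<in>?K. N k k \<epsilon>))" for \<epsilon>
    proof -
      have "(\<Prod>k = 0..<n. N k (Transposition.transpose i j k) \<epsilon>)
          = N i (Transposition.transpose i j i) \<epsilon> * (N j (Transposition.transpose i j j) \<epsilon> * (\<Prod>k\<in>?K. N k (Transposition.transpose i j k) \<epsilon>))"
        using ij by (subst prod.remove[of _ i], simp, simp, subst prod.remove[of _ j]) simp_all
      also have "(\<Prod>k\<in>?K. N k (Transposition.transpose i j k) \<epsilon>) = (\<Prod>k\<in>?K. N k k \<epsilon>)"
        by (intro prod.cong) (auto simp: Transposition.transpose_def)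
      finally show ?thesis using ij by (simp add: t_def sign_swap_id)
    qed
    \<comment> \<open>The two swapped entries already give O(\<epsilon>^2), so replacing the
      remaining diagonal product by 1 costs O(\<epsilon>^4).\<close>
    moreover have "(\<lambda>\<epsilon>. (-1) * (N i j \<epsilon> * N j i \<epsilon> * ((\<Prod>k\<in>?K. N k k \<epsilon>) - 1))
        + (-1) * (N i j \<epsilon> * N j i \<epsilon> - a i j * a j i * \<epsilon> ^ 2)) \<in> ?O 4"
      using mult[OF two'[of i j] rest[OF K]] two[of i j] ij
      by (intro sum_in_bigo(1) bigo_cmult) auto
    ultimately show ?thesis by (simp add: algebra_simps)
  qed
  have "(\<lambda>\<epsilon>. \<Sum>j<n. \<Sum>i<j. t (Transposition.transpose i j) \<epsilon> + a i j * a j i * \<epsilon> ^ 2) \<in> ?O 4"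
    by (intro big_sum_in_bigo t_transpose) auto
  note O = sum_in_bigo(1)[OF sum_in_bigo(1)[OF t_id this] R]
  have "(\<Sum>j<n. \<Sum>i<j. t (Transposition.transpose i j) \<epsilon> + a i j * a j i * \<epsilon> ^ 2)
      = (\<Sum>j<n. \<Sum>i<j. t (Transposition.transpose i j) \<epsilon>) + (\<Sum>j<n. \<Sum>i<j. a i j * a j i) * \<epsilon> ^ 2" for \<epsilon>
    by (simp add: sum.distrib sum_distrib_right)
  moreover have "(t0 + (T + R)) - (1 + (S - A) * e) = (t0 - (1 + S * e)) + (T + A * e) + R" for t0 T R S A e :: real
    by (simp add: algebra_simps)
  ultimately show ?thesis using O by (simp only: det)
qed

section \<open>The expansion of the Hankel determinant\<close>

text \<open>Each Leibniz term uses every row and every column exactly once, so the scale factors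
  come out as a common product.\<close>

lemma det_scale_rows_cols:
  fixes X :: "nat \<Rightarrow> nat \<Rightarrow> real"
  shows "Determinant.det (mat n n (\<lambda>(i, j). r i * c j * X i j))
    = (\<Prod>i<n. r i * c i) * Determinant.det (mat n n (\<lambda>(i, j). X i j))"
proof -
  have "(\<Prod>i = 0..<n. r i * c (p i) * X i (p i)) = (\<Prod>i<n. r i * c i) * (\<Prod>i = 0..<n. X i (p i))"
    if "p permutes {0..<n}" for p
    using prod.permute[OF that, of c] by (simp add: prod.distrib atLeast0LessThan o_def)
  moreover have "Determinant.det (mat n n (\<lambda>(i, j). Y i j))
      = (\<Sum>p\<in>{p. p permutes {0..<n}}. signof p * (\<Prod>i = 0..<n. Y i (p i)))" for Y :: "nat \<Rightarrow> nat \<Rightarrow> real"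
    by (subst det_def'[of _ n]) (auto intro!: sum.cong prod.cong dest: permutes_in_image)
  ultimately show ?thesis
    by (simp add: sum_distrib_left mult.left_commute)
qed

lemma lin_fun_cmult: "lin_fun (\<lambda>m. c * h m) p = c * lin_fun h p"
  by (simp add: lin_fun_def sum_distrib_left mult_ac)

text \<open>A change of variable turns the functional into the one whose moments are its values at
  the powers of \<open>l\<close>. The extra factor \<open>l ^ k\<close> carries the
  induction.\<close>

lemma lin_fun_pcompose:
  "lin_fun h (l ^ k * pcompose r l) = lin_fun (\<lambda>m. lin_fun h (l ^ (m + k))) r"
proof (induction r arbitrary: k)
  case (pCons a p)
  have "l ^ k * pcompose (pCons a p) l = Polynomial.smult a (l ^ k) + l ^ Suc k * pcompose p l"
    by (simp add: pcompose_pCons algebra_simps)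
  then show ?case
    using pCons.IH[of "Suc k"] by (simp add: lin_fun_linear lin_fun_pCons)
qed simp

lemma weight_moment_integrable:
  assumes "\<epsilon> > 0"
  shows "set_integrable lborel {0<..} (\<lambda>x. x ^ j * weight (1 / \<epsilon> ^ 4) \<alpha> x)"
proof -
  have "set_integrable lborel {0<..} (weight (1 / \<epsilon> ^ 4) (\<alpha> + real j))"
    using weight_substitution(1)[OF assms, of 0 "\<alpha> + real j"] by simp
  also have "?this \<longleftrightarrow> ?thesis"
    by (rule set_integrable_cong) (auto simp: weight_def powr_add powr_realpow)
  finally show ?thesis .
qed

lemma lin_fun_moment:
  assumes "\<epsilon> > 0"
  shows "lin_fun (\<lambda>j. moment j (1 / \<epsilon> ^ 4) \<alpha>) p = (LINT x:{0<..}|lborel. poly p x * weight (1 / \<epsilon> ^ 4) \<alpha> x)"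
proof -
  have "(LINT x:{0<..}|lborel. poly p x * weight (1 / \<epsilon> ^ 4) \<alpha> x)
    = (LINT x|lborel. (\<Sum>j\<le>degree p. coeff p j * (indicator {0<..} x *\<^sub>R (x ^ j * weight (1 / \<epsilon> ^ 4) \<alpha> x))))"
    unfolding set_lebesgue_integral_def
    by (intro Bochner_Integration.integral_cong refl) (simp add: poly_altdef sum_distrib_left sum_distrib_right mult_ac)
  also have "\<dots> = (\<Sum>j\<le>degree p. coeff p j * (LINT x|lborel. indicator {0<..} x *\<^sub>R (x ^ j * weight (1 / \<epsilon> ^ 4) \<alpha> x)))"
    using weight_moment_integrable[OF assms]
    by (subst Bochner_Integration.integral_sum) (auto simp: set_integrable_def)
  finally show ?thesis
    by (simp add: lin_fun_def moment_def set_lebesgue_integral_def)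
qed

text \<open>Dividing by the norm of the row alone makes the matrix tend to the identity while
  keeping every factor rational in the norms.\<close>

definition scaled_entry :: "real \<Rightarrow> nat \<Rightarrow> nat \<Rightarrow> real \<Rightarrow> real" where
  "scaled_entry \<nu> i j \<epsilon> = lin_fun (\<lambda>m. gfac_moment (m / 2 + \<nu>) m \<epsilon>) (herm i * herm j) / herm_norm i"

text \<open>Each row and each column of index \<open>i\<close> contributes
  \<open>(1 / \<epsilon>) ^ i\<close> from making the Hermite polynomials monic in \<open>x\<close>;
  the rest of the prefactor is the constant of the substitution and the row norm.\<close>

lemma hankel_scaled:
  assumes \<epsilon>: "\<epsilon> > 0"
  shows "hankel_D n (1 / \<epsilon> ^ 4) \<alpha>
    = (\<Prod>i<n. \<epsilon> * (1 / \<epsilon>\<^sup>2) powr (\<alpha> + 1) * exp (- 2 / \<epsilon>\<^sup>2) * (1 / \<epsilon>\<^sup>2) ^ i * herm_norm i)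
      * Determinant.det (mat n n (\<lambda>(i, j). scaled_entry (\<alpha> + 1) i j \<epsilon>))"
proof -
  define K where "K = \<epsilon> * (1 / \<epsilon>\<^sup>2) powr (\<alpha> + 1) * exp (- 2 / \<epsilon>\<^sup>2)"
  \<comment> \<open>As a polynomial in \<open>x\<close> this is
    \<open>\<epsilon> * (x - 1 / \<epsilon>^2)\<close>, the variable whose weighted moments
    \<open>weight_substitution\<close> computes.\<close>
  define l where "l = [:- 1 / \<epsilon>, \<epsilon>:]"
  define q where "q i = Polynomial.smult ((1 / \<epsilon>) ^ i) (pcompose (herm i) l)" for i
  define \<mu> where "\<mu> j = moment j (1 / \<epsilon> ^ 4) \<alpha>" for j
  have l: "lin_fun \<mu> (l ^ m) = K * gfac_moment (m / 2 + (\<alpha> + 1)) m \<epsilon>" for m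
  proof -
    have "x * \<epsilon> - 1 / \<epsilon> = \<epsilon> * (x - 1 / \<epsilon>\<^sup>2)" for x
      using \<epsilon> by (simp add: field_simps power2_eq_square)
    then have "poly (l ^ m) x = (\<epsilon> * (x - 1 / \<epsilon>\<^sup>2)) ^ m" for x
      by (simp add: l_def poly_power)
    then show ?thesis
      unfolding \<mu>_def lin_fun_moment[OF \<epsilon>] K_def using weight_substitution(2)[OF \<epsilon>] by simp
  qed
  have degl: "degree l = 1" "lead_coeff l = \<epsilon>" using \<epsilon> by (simp_all add: l_def)
  have degq: "degree (q i) = i" for i
    using \<epsilon> degl by (simp add: q_def degree_pcompose)
  have "lead_coeff (pcompose (herm i) l) = \<epsilon> ^ i" for i
    using lead_coeff_comp[of l "herm i"] degl by simp
  then have monic: "coeff (q i) i = 1" for i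
    using \<epsilon> degl by (simp add: q_def degree_pcompose power_mult_distrib[symmetric])
  have entry: "lin_fun \<mu> (q i * q j) = (K * (1 / \<epsilon>) ^ i * herm_norm i) * (1 / \<epsilon>) ^ j * scaled_entry (\<alpha> + 1) i j \<epsilon>" for i j
  proof -
    have "q i * q j = Polynomial.smult ((1 / \<epsilon>) ^ i * (1 / \<epsilon>) ^ j) (l ^ 0 * pcompose (herm i * herm j) l)"
      by (simp add: q_def pcompose_mult mult.commute)
    then have "lin_fun \<mu> (q i * q j) = (1 / \<epsilon>) ^ i * (1 / \<epsilon>) ^ j * lin_fun (\<lambda>m. lin_fun \<mu> (l ^ m)) (herm i * herm j)"
      by (simp only: lin_fun_smult lin_fun_pcompose add_0_right)
    also have "\<dots> = (1 / \<epsilon>) ^ i * (1 / \<epsilon>) ^ j * (K * (herm_norm i * scaled_entry (\<alpha> + 1) i j \<epsilon>))"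
      using herm_norm_pos[of i] by (simp add: l lin_fun_cmult scaled_entry_def)
    finally show ?thesis by (simp add: mult_ac)
  qed
  have "hankel_D n (1 / \<epsilon> ^ 4) \<alpha> = Determinant.det (mat n n (\<lambda>(i, j). lin_fun \<mu> (q i * q j)))"
    unfolding hankel_D_def \<mu>_def[symmetric] by (rule det_lin_fun_monic_basis[OF degq monic, symmetric])
  also have "\<dots> = (\<Prod>i<n. (K * (1 / \<epsilon>) ^ i * herm_norm i) * (1 / \<epsilon>) ^ i) * Determinant.det (mat n n (\<lambda>(i, j). scaled_entry (\<alpha> + 1) i j \<epsilon>))"
    unfolding entry by (rule det_scale_rows_cols)
  also have "(\<Prod>i<n. (K * (1 / \<epsilon>) ^ i * herm_norm i) * (1 / \<epsilon>) ^ i) = (\<Prod>i<n. K * (1 / \<epsilon>\<^sup>2) ^ i * herm_norm i)"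
  proof (intro prod.cong refl)
    fix i
    have "(1 / \<epsilon>\<^sup>2) ^ i = (1 / \<epsilon>) ^ i * (1 / \<epsilon>) ^ i"
      unfolding power_mult_distrib[symmetric] by (simp add: power2_eq_square)
    then show "(K * (1 / \<epsilon>) ^ i * herm_norm i) * (1 / \<epsilon>) ^ i = K * (1 / \<epsilon>\<^sup>2) ^ i * herm_norm i"
      by (simp only: mult_ac)
  qed
  finally show ?thesis by (simp add: K_def)
qed

section \<open>Expansion of the entries and of their determinant\<close>

lemma lin_fun_herm_parity:
  assumes "\<And>m. even (m + i + j) \<Longrightarrow> h m = 0"
  shows "lin_fun h (herm i * herm j) = 0"
  unfolding lin_fun_def using assms coeff_herm_mult_parity by (intro sum.neutral) (metis mult_eq_0_iff)

text \<open>The expansion of \<open>gfac_moment\<close> is summed against the coefficients of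
  \<open>herm i * herm j\<close>. The cubic coefficient stays unnamed: only its vanishing for even
  \<open>i + j\<close> matters.\<close>

lemma scaled_entry_expansion:
  obtains d where "(\<lambda>\<epsilon>. scaled_entry \<nu> i j \<epsilon> - ((if i = j then 1 else 0)
      + lin_fun gauss_moment ([:0, \<nu> - 1, 0, 1:] * (herm i * herm j)) / herm_norm i * \<epsilon>
      + lin_fun gauss_moment ([:0, 0, (\<nu> - 1) * (\<nu> - 2) / 2, 0, \<nu> - 2, 0, 1 / 2:] * (herm i * herm j)) / herm_norm i * \<epsilon> ^ 2
      + d * \<epsilon> ^ 3)) \<in> O[at_right 0](\<lambda>\<epsilon>. \<epsilon> ^ 4)"
    and "even (i + j) \<Longrightarrow> d = 0"
proof -
  let ?p = "herm i * herm j" and ?L = "lin_fun gauss_moment"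
  define \<kappa> where "\<kappa> m = real m / 2 + \<nu>" for m
  define T where "T m = (\<kappa> m ^ 3 - \<kappa> m) / 6 * gauss_moment (m + 3)" for m
  have "(\<lambda>\<epsilon>. 1 / herm_norm i * (\<Sum>m\<le>degree ?p. coeff ?p m * (gfac_moment (\<kappa> m) m \<epsilon> - (gauss_moment m + \<kappa> m * gauss_moment (m + 1) * \<epsilon>
      + (4 * (\<kappa> m)\<^sup>2 - 1) / 8 * gauss_moment (m + 2) * \<epsilon> ^ 2
      + (\<kappa> m ^ 3 - \<kappa> m) / 6 * gauss_moment (m + 3) * \<epsilon> ^ 3)))) \<in> O[at_right 0](\<lambda>\<epsilon>. \<epsilon> ^ 4)"
    by (intro bigo_cmult big_sum_in_bigo gfac_moment_expansion)
  also have "(\<lambda>\<epsilon>. 1 / herm_norm i * (\<Sum>m\<le>degree ?p. coeff ?p m * (gfac_moment (\<kappa> m) m \<epsilon> - (gauss_moment m + \<kappa> m * gauss_moment (m + 1) * \<epsilon>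
      + (4 * (\<kappa> m)\<^sup>2 - 1) / 8 * gauss_moment (m + 2) * \<epsilon> ^ 2
      + (\<kappa> m ^ 3 - \<kappa> m) / 6 * gauss_moment (m + 3) * \<epsilon> ^ 3))))
    = (\<lambda>\<epsilon>. scaled_entry \<nu> i j \<epsilon> - (?L ?p / herm_norm i
      + lin_fun (\<lambda>m. \<kappa> m * gauss_moment (m + 1)) ?p / herm_norm i * \<epsilon>
      + lin_fun (\<lambda>m. (4 * (\<kappa> m)\<^sup>2 - 1) / 8 * gauss_moment (m + 2)) ?p / herm_norm i * \<epsilon> ^ 2
      + lin_fun T ?p / herm_norm i * \<epsilon> ^ 3))"
  proof
    fix \<epsilon>
    have "(\<Sum>m\<le>degree ?p. coeff ?p m * (gfac_moment (\<kappa> m) m \<epsilon> - (gauss_moment m + \<kappa> m * gauss_moment (m + 1) * \<epsilon>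
      + (4 * (\<kappa> m)\<^sup>2 - 1) / 8 * gauss_moment (m + 2) * \<epsilon> ^ 2
      + (\<kappa> m ^ 3 - \<kappa> m) / 6 * gauss_moment (m + 3) * \<epsilon> ^ 3)))
      = lin_fun (\<lambda>m. gfac_moment (\<kappa> m) m \<epsilon>) ?p - (?L ?p + lin_fun (\<lambda>m. \<kappa> m * gauss_moment (m + 1)) ?p * \<epsilon>
      + lin_fun (\<lambda>m. (4 * (\<kappa> m)\<^sup>2 - 1) / 8 * gauss_moment (m + 2)) ?p * \<epsilon> ^ 2
      + lin_fun T ?p * \<epsilon> ^ 3)"
      unfolding lin_fun_def T_def sum_distrib_right sum.distrib[symmetric] sum_subtractf[symmetric]
      by (intro sum.cong refl) (simp only: right_diff_distrib distrib_left mult.assoc)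
    then show "1 / herm_norm i * (\<Sum>m\<le>degree ?p. coeff ?p m * (gfac_moment (\<kappa> m) m \<epsilon> - (gauss_moment m + \<kappa> m * gauss_moment (m + 1) * \<epsilon>
      + (4 * (\<kappa> m)\<^sup>2 - 1) / 8 * gauss_moment (m + 2) * \<epsilon> ^ 2
      + (\<kappa> m ^ 3 - \<kappa> m) / 6 * gauss_moment (m + 3) * \<epsilon> ^ 3)))
      = scaled_entry \<nu> i j \<epsilon> - (?L ?p / herm_norm i
      + lin_fun (\<lambda>m. \<kappa> m * gauss_moment (m + 1)) ?p / herm_norm i * \<epsilon>
      + lin_fun (\<lambda>m. (4 * (\<kappa> m)\<^sup>2 - 1) / 8 * gauss_moment (m + 2)) ?p / herm_norm i * \<epsilon> ^ 2
      + lin_fun T ?p / herm_norm i * \<epsilon> ^ 3)"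
      by (simp only: scaled_entry_def \<kappa>_def) (simp add: diff_divide_distrib add_divide_distrib)
  qed
  also have "?L ?p / herm_norm i = (if i = j then 1 else 0)"
    using herm_norm_pos[of i] by (auto simp: herm_orthogonal)
  finally have "(\<lambda>\<epsilon>. scaled_entry \<nu> i j \<epsilon> - ((if i = j then 1 else 0)
      + ?L ([:0, \<nu> - 1, 0, 1:] * ?p) / herm_norm i * \<epsilon>
      + ?L ([:0, 0, (\<nu> - 1) * (\<nu> - 2) / 2, 0, \<nu> - 2, 0, 1 / 2:] * ?p) / herm_norm i * \<epsilon> ^ 2
      + lin_fun T ?p / herm_norm i * \<epsilon> ^ 3)) \<in> O[at_right 0](\<lambda>\<epsilon>. \<epsilon> ^ 4)"
    unfolding \<kappa>_def gfac_moment_coeff1 gfac_moment_coeff2 .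
  moreover have "lin_fun T ?p / herm_norm i = 0" if "even (i + j)"
    using that by (subst lin_fun_herm_parity) (auto simp: T_def gauss_moment_odd)
  ultimately show ?thesis using that by blast
qed

text \<open>By parity, entries with \<open>i + j\<close> even have no odd-order terms up to the
  third and the others have no second-order term, as \<open>det_near_identity\<close>
  requires.\<close>

lemma det_scaled_entry_expansion:
  "(\<lambda>\<epsilon>. Determinant.det (mat n n (\<lambda>(i, j). scaled_entry \<nu> i j \<epsilon>))
      - (1 + real n * (4 * (\<nu> - 1 + real n)\<^sup>2 - 1) / 16 * \<epsilon> ^ 2)) \<in> O[at_right 0](\<lambda>\<epsilon>. \<epsilon> ^ 4)"
proof -
  let ?L = "lin_fun gauss_moment"
  define a where "a i j = ?L ([:0, \<nu> - 1, 0, 1:] * (herm i * herm j)) / herm_norm i" for i j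
  define b where "b i j = ?L ([:0, 0, (\<nu> - 1) * (\<nu> - 2) / 2, 0, \<nu> - 2, 0, 1 / 2:] * (herm i * herm j)) / herm_norm i" for i j
  have a0: "a i j = 0" if "even (i + j)" for i j
    unfolding a_def gfac_moment_coeff1[symmetric] using that
    by (subst lin_fun_herm_parity) (auto simp: gauss_moment_odd)
  have b0: "b i j = 0" if "odd (i + j)" for i j
  proof -
    have "odd (m + 2)" if "even (m + i + j)" for m
      using that \<open>odd (i + j)\<close> by presburger
    then have g: "gauss_moment (m + 2) = 0" if "even (m + i + j)" for m
      using that by (intro gauss_moment_odd)
    have "lin_fun (\<lambda>m. (4 * (real m / 2 + \<nu>)\<^sup>2 - 1) / 8 * gauss_moment (m + 2)) (herm i * herm j) = 0"
      by (rule lin_fun_herm_parity, drule g, simp only: mult_zero_right)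
    then show ?thesis
      unfolding b_def gfac_moment_coeff2[symmetric] by simp
  qed
  have bd: "b i i = herm_diag \<nu> (real i)" for i
    unfolding b_def herm_matrix_diag using herm_norm_pos[of i] by simp
  have aa: "a i j * a j i = herm_off \<nu> i j" for i j
    by (simp add: a_def herm_off_def power2_eq_square mult.commute[of "herm j" "herm i"])
  have N: "\<exists>d. (\<lambda>\<epsilon>. scaled_entry \<nu> i j \<epsilon> - ((if i = j then 1 else 0) + a i j * \<epsilon> + b i j * \<epsilon> ^ 2 + d * \<epsilon> ^ 3)) \<in> O[at_right 0](\<lambda>\<epsilon>. \<epsilon> ^ 4)
      \<and> (even (i + j) \<longrightarrow> d = 0)" for i j
    unfolding a_def b_def by (rule scaled_entry_expansion[of \<nu> i j], rule exI, rule conjI, assumption, rule impI)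
  have "(\<lambda>\<epsilon>. Determinant.det (mat n n (\<lambda>(i, j). scaled_entry \<nu> i j \<epsilon>))
      - (1 + ((\<Sum>i<n. herm_diag \<nu> (real i)) - (\<Sum>j<n. \<Sum>i<j. a i j * a j i)) * \<epsilon> ^ 2)) \<in> O[at_right 0](\<lambda>\<epsilon>. \<epsilon> ^ 4)"
  proof (rule det_near_identity)
    fix i
    show "(\<lambda>\<epsilon>. scaled_entry \<nu> i i \<epsilon> - (1 + herm_diag \<nu> (real i) * \<epsilon> ^ 2)) \<in> O[at_right 0](\<lambda>\<epsilon>. \<epsilon> ^ 4)"
      using N[of i i] a0[of i i] bd[of i] by auto
  next
    fix i j :: nat assume odd: "odd (i + j)"
    then have "i \<noteq> j" by auto
    moreover from N[of i j] obtain d where d: "(\<lambda>\<epsilon>. scaled_entry \<nu> i j \<epsilon> - ((if i = j then 1 else 0) + a i j * \<epsilon> + b i j * \<epsilon> ^ 2 + d * \<epsilon> ^ 3)) \<in> O[at_right 0](\<lambda>\<epsilon>. \<epsilon> ^ 4)"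
      by blast
    ultimately have "(\<lambda>\<epsilon>. scaled_entry \<nu> i j \<epsilon> - a i j * \<epsilon> - d * \<epsilon> ^ 3) \<in> O[at_right 0](\<lambda>\<epsilon>. \<epsilon> ^ 4)"
      using b0[OF odd] by (simp add: diff_diff_eq)
    also have "(\<lambda>\<epsilon>::real. \<epsilon> ^ 4) \<in> O[at_right 0](\<lambda>\<epsilon>. \<epsilon> ^ 3)" by (rule power_bigo_at_right_0) simp
    finally have "(\<lambda>\<epsilon>. (scaled_entry \<nu> i j \<epsilon> - a i j * \<epsilon> - d * \<epsilon> ^ 3) + d * \<epsilon> ^ 3) \<in> O[at_right 0](\<lambda>\<epsilon>. \<epsilon> ^ 3)"
      by (intro sum_in_bigo(1) bigo_cmult) simp_all
    then show "(\<lambda>\<epsilon>. scaled_entry \<nu> i j \<epsilon> - a i j * \<epsilon>) \<in> O[at_right 0](\<lambda>\<epsilon>. \<epsilon> ^ 3)" by simp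
  next
    fix i j :: nat assume "i \<noteq> j" "even (i + j)"
    then have "(\<lambda>\<epsilon>. scaled_entry \<nu> i j \<epsilon> - b i j * \<epsilon> ^ 2) \<in> O[at_right 0](\<lambda>\<epsilon>. \<epsilon> ^ 4)"
      using N[of i j] a0[of i j] by auto
    also have "(\<lambda>\<epsilon>::real. \<epsilon> ^ 4) \<in> O[at_right 0](\<lambda>\<epsilon>. \<epsilon> ^ 2)" by (rule power_bigo_at_right_0) simp
    finally have "(\<lambda>\<epsilon>. (scaled_entry \<nu> i j \<epsilon> - b i j * \<epsilon> ^ 2) + b i j * \<epsilon> ^ 2) \<in> O[at_right 0](\<lambda>\<epsilon>. \<epsilon> ^ 2)"
      by (intro sum_in_bigo(1) bigo_cmult) simp_all
    then show "scaled_entry \<nu> i j \<in> O[at_right 0](\<lambda>\<epsilon>. \<epsilon> ^ 2)" by simp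
  qed (rule a0)
  then show ?thesis
    unfolding aa second_order_coefficient .
qed

section \<open>Passage to the logarithm and back to the variable \<open>t\<close>\<close>

lemma ln_expansion:
  fixes f :: "real \<Rightarrow> real"
  assumes "(\<lambda>\<epsilon>. f \<epsilon> - (1 + c * \<epsilon> ^ 2)) \<in> O[at_right 0](\<lambda>\<epsilon>. \<epsilon> ^ 4)"
  shows "(\<lambda>\<epsilon>. ln (f \<epsilon>) - c * \<epsilon> ^ 2) \<in> O[at_right 0](\<lambda>\<epsilon>. \<epsilon> ^ 4)"
    and "eventually (\<lambda>\<epsilon>. f \<epsilon> > 0) (at_right 0)"
proof -
  define x where "x \<epsilon> = f \<epsilon> - 1" for \<epsilon>
  have "(\<lambda>\<epsilon>. (f \<epsilon> - (1 + c * \<epsilon> ^ 2)) + c * \<epsilon> ^ 2) \<in> O[at_right 0](\<lambda>\<epsilon>. \<epsilon> ^ 2)"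
    by (intro sum_in_bigo(1) bigo_cmult landau_o.big.trans[OF assms] power_bigo_at_right_0) simp_all
  then have x: "x \<in> O[at_right 0](\<lambda>\<epsilon>. \<epsilon> ^ 2)" by (simp add: x_def[abs_def])
  have "(\<lambda>\<epsilon>::real. \<epsilon> ^ 2) \<in> o[at_right 0](\<lambda>_. 1)" by real_asymp
  from smalloD_tendsto[OF landau_o.big_small_trans[OF x this]]
  have "(x \<longlongrightarrow> 0) (at_right 0)" by simp
  \<comment> \<open>For \<open>\<bar>x\<bar> \<le> 1 / 2\<close> one has
    \<open>\<bar>ln (1 + x) - x\<bar> \<le> 2 * x^2\<close>.\<close>
  then have small: "eventually (\<lambda>\<epsilon>. \<bar>x \<epsilon>\<bar> < 1 / 2) (at_right 0)"
    using tendstoD[of x 0 "at_right 0" "1/2"] by simp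
  then show "eventually (\<lambda>\<epsilon>. f \<epsilon> > 0) (at_right 0)"
    unfolding x_def by eventually_elim linarith
  have "(\<lambda>\<epsilon>. ln (1 + x \<epsilon>) - x \<epsilon>) \<in> O[at_right 0](\<lambda>\<epsilon>. x \<epsilon> * x \<epsilon>)"
    using small by (intro bigoI[of _ 2], eventually_elim)
      (use abs_ln_one_plus_x_minus_x_bound in \<open>auto simp: power2_eq_square\<close>)
  also have "(\<lambda>\<epsilon>. x \<epsilon> * x \<epsilon>) \<in> O[at_right 0](\<lambda>\<epsilon>. \<epsilon> ^ 2 * \<epsilon> ^ 2)"
    by (intro landau_o.big.mult x)
  finally have "(\<lambda>\<epsilon>. (ln (1 + x \<epsilon>) - x \<epsilon>) + (f \<epsilon> - (1 + c * \<epsilon> ^ 2))) \<in> O[at_right 0](\<lambda>\<epsilon>. \<epsilon> ^ 4)"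
    by (intro sum_in_bigo(1) assms) (simp add: power_add[symmetric])
  then show "(\<lambda>\<epsilon>. ln (f \<epsilon>) - c * \<epsilon> ^ 2) \<in> O[at_right 0](\<lambda>\<epsilon>. \<epsilon> ^ 4)"
    by (simp add: x_def)
qed

text \<open>The functional equation of the Barnes function contributes \<open>ln (fact n)\<close> at
  each step, which is the factorial in \<open>herm_norm n\<close>. The constant is thus the
  logarithm of the product of the Hermite norms.\<close>

lemma C_tilde_eq_sum: "C_tilde n = (\<Sum>i<n. ln (herm_norm i))"
proof (induction n)
  case 0
  then show ?case by (simp add: C_tilde_def)
next
  case (Suc n)
  have "ln (barnes_G (real n + 1 + 1)) = ln (fact n) + ln (barnes_G (real n + 1))"
    using barnes_G_pos[of "real n + 1"] Gamma_fact[of n, where 'a = real]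
    by (subst barnes_G_plus1) (simp_all add: ln_mult add.commute)
  then have "C_tilde (Suc n) = C_tilde n + (ln pi / 2 + ln (fact n) - real n * ln 2)"
    by (simp add: C_tilde_def field_simps)
  also have "ln pi / 2 + ln (fact n) - real n * ln 2 = ln (herm_norm n)"
    by (simp add: herm_norm_def ln_mult ln_div ln_sqrt ln_realpow)
  finally show ?case using Suc by simp
qed

text \<open>The powers of \<epsilon> in the prefactor add up to the sum of
  \<open>1 - 2 * (\<alpha> + 1) - 2 * i\<close> over \<open>i < n\<close>, that is
  \<open>- n * (2 * \<alpha> + n)\<close>.\<close>

lemma ln_hankel_scaled:
  assumes \<epsilon>: "\<epsilon> > 0" and pos: "Determinant.det (mat n n (\<lambda>(i, j). scaled_entry (\<alpha> + 1) i j \<epsilon>)) > 0" (is "?d > 0")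
  shows "ln (hankel_D n (1 / \<epsilon> ^ 4) \<alpha>)
    = - 2 * real n / \<epsilon>\<^sup>2 - real n * (2 * \<alpha> + real n) * ln \<epsilon> + C_tilde n + ln ?d"
proof -
  let ?g = "\<lambda>i. \<epsilon> * (1 / \<epsilon>\<^sup>2) powr (\<alpha> + 1) * exp (- 2 / \<epsilon>\<^sup>2) * (1 / \<epsilon>\<^sup>2) ^ i * herm_norm i"
  have g: "?g i > 0" for i using \<epsilon> herm_norm_pos[of i] by simp
  have l2: "ln (1 / \<epsilon>\<^sup>2) = - 2 * ln \<epsilon>" using \<epsilon> by (simp add: ln_div ln_realpow)
  have lg: "ln (?g i) = (ln \<epsilon> - 2 * (\<alpha> + 1) * ln \<epsilon> - 2 / \<epsilon>\<^sup>2) - 2 * ln \<epsilon> * real i + ln (herm_norm i)" for i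
    using \<epsilon> herm_norm_pos[of i] by (simp add: ln_mult ln_powr ln_realpow l2)
  have "ln (\<Prod>i<n. ?g i) = (\<Sum>i<n. ln (?g i))"
    by (rule ln_prod) (use \<epsilon> in \<open>auto simp: herm_norm_def\<close>)
  also have "\<dots> = - 2 * real n / \<epsilon>\<^sup>2 - real n * (2 * \<alpha> + real n) * ln \<epsilon> + C_tilde n"
    unfolding lg C_tilde_eq_sum
  proof (induction n)
    case (Suc n)
    then show ?case by (simp add: algebra_simps add_divide_distrib diff_divide_distrib)
  qed simp
  finally have lp: "ln (\<Prod>i<n. ?g i) = - 2 * real n / \<epsilon>\<^sup>2 - real n * (2 * \<alpha> + real n) * ln \<epsilon> + C_tilde n" .
  have P: "(\<Prod>i<n. ?g i) > 0"
    by (rule prod_pos) (use g in blast)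
  show ?thesis
    unfolding hankel_scaled[OF \<epsilon>] lp[symmetric] by (rule ln_mult_pos[OF P pos])
qed

theorem theorem5p4:
  fixes \<alpha> :: real and n :: nat
  assumes "\<alpha> > -1" and "n \<ge> 1"
  shows "(\<lambda>t. ln (hankel_D n t \<alpha>) -
           (- 2 * real n * sqrt t + real n * (2 * \<alpha> + real n) / 4 * ln t + C_tilde n
            + real n * (4 * (\<alpha> + real n)\<^sup>2 - 1) / (16 * sqrt t)))
         \<in> O[at_top](\<lambda>t. 1 / t)"
proof -
  let ?d = "\<lambda>\<epsilon>. Determinant.det (mat n n (\<lambda>(i, j). scaled_entry (\<alpha> + 1) i j \<epsilon>))"
  define c where "c = real n * (4 * (\<alpha> + real n)\<^sup>2 - 1) / 16"
  \<comment> \<open>The positive solution \<epsilon> of \<open>t = 1 / \<epsilon> ^ 4\<close>; it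
    tends to 0 from the right as \<open>t\<close> grows.\<close>
  define e where "e t = 1 / sqrt (sqrt t)" for t :: real
  have d: "(\<lambda>\<epsilon>. ?d \<epsilon> - (1 + c * \<epsilon> ^ 2)) \<in> O[at_right 0](\<lambda>\<epsilon>. \<epsilon> ^ 4)"
    using det_scaled_entry_expansion[of n "\<alpha> + 1"] by (simp add: c_def)
  have lim: "filterlim e (at_right 0) at_top"
    unfolding e_def by real_asymp
  have O: "(\<lambda>t. ln (?d (e t)) - c * e t ^ 2) \<in> O[at_top](\<lambda>t. e t ^ 4)"
    by (rule landau_o.big.compose[OF ln_expansion(1)[OF d] lim])
  have ev: "eventually (\<lambda>t. ?d (e t) > 0) at_top"
    using ln_expansion(2)[OF d] lim by (rule eventually_compose_filterlim)
  have e4: "e t ^ 4 = 1 / t" and e2: "(e t)\<^sup>2 = 1 / sqrt t" and le: "ln (e t) = - ln t / 4" and e0: "e t > 0" if "t > 0" for t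
  proof -
    show e2: "(e t)\<^sup>2 = 1 / sqrt t" using that by (simp add: e_def power_divide)
    have "e t ^ 4 = ((e t)\<^sup>2)\<^sup>2" by simp
    then show "e t ^ 4 = 1 / t" using that by (simp add: e2 power_divide)
    show "ln (e t) = - ln t / 4" "e t > 0" using that by (simp_all add: e_def ln_div ln_sqrt)
  qed
  \<comment> \<open>The identity is asserted for large \<open>t\<close>, where the determinant is
    known to be positive and its logarithm splits off.\<close>
  have "eventually (\<lambda>t. ln (?d (e t)) - c * e t ^ 2 = ln (hankel_D n t \<alpha>) -
           (- 2 * real n * sqrt t + real n * (2 * \<alpha> + real n) / 4 * ln t + C_tilde n
            + real n * (4 * (\<alpha> + real n)\<^sup>2 - 1) / (16 * sqrt t))) at_top"
    using ev eventually_gt_at_top[of 0]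
  proof eventually_elim
    case (elim t)
    have "ln (hankel_D n t \<alpha>) = - 2 * real n * sqrt t + real n * (2 * \<alpha> + real n) / 4 * ln t + C_tilde n + ln (?d (e t))"
      using ln_hankel_scaled[OF e0[OF elim(2)] elim(1)] elim(2) by (simp add: e4 e2 le)
    moreover have "c * e t ^ 2 = real n * (4 * (\<alpha> + real n)\<^sup>2 - 1) / (16 * sqrt t)"
      using elim(2) by (simp add: e2 c_def)
    ultimately show ?case by simp
  qed
  note iffD1[OF landau_o.big.in_cong[OF this] O]
  moreover have "eventually (\<lambda>t. e t ^ 4 = 1 / t) at_top"
    using eventually_gt_at_top[of 0] by eventually_elim (rule e4)
  from landau_o.big.cong[OF this] have "O[at_top](\<lambda>t. e t ^ 4) = O[at_top](\<lambda>t. 1 / t)" .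
  ultimately show ?thesis by (simp only:)
qed

end
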